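(* Every fine diffeological vector space is Frölicher.
   Context: A diffeological space is a set $X$ together with a specified set of functions $U\to X$ (called plots), for every open set $U\subseteq\mathbb{R}^n$ and every $n\in\mathbb{N}=\{0,1,2,\dots\}$, such that: (1) every constant map $U\to X$ is a plot; (2) if $U\to X$ is a plot and $V\to U$ is a smooth map between open subsets of Euclidean spaces, then $V\to U\to X$ is a plot; (3) if $U=\bigcup_i U_i$ is an open cover and $U\to X$ is a map whose restrictions to all $U_i$ are plots, then $U\to X$ is a plot. A map between diffeological spaces is smooth if composing with it sends plots to plots. Products carry the product diffeology, and $\mathbb{R}$ carries the standard diffeology. A diffeological vector space is a real vector space $V$ with a diffeology such that addition $V\times V\to V$ and scalar multiplication $\mathbb{R}\times V\to V$ are smooth. The fine diffeology on a real vector space $V$ is the smallest diffeology making $V$ a diffeological vector space; it is the diffeology generated by all linear maps $\mathbb{R}^n\to V$, $n\in\mathbb{N}$ (i.e. plots are the maps which locally have the form $l\circ f$ with $f$ smooth into some $\mathbb{R}^n$ and $l:\mathbb{R}^n\to V$ linear). A fine diffeological vector space is a vector space with the fine diffeology. A Frölicher space is a triple $(\mathcal{C},Y,\mathcal{F})$ where $Y$ is a set, $\mathcal{C}$ is a set of maps $\mathbb{R}\to Y$ and $\mathcal{F}$ is a set of maps $Y\to\mathbb{R}$ such that $\mathcal{F}=\{f:Y\to\mathbb{R}\mid f\circ c\in C^\infty(\mathbb{R},\mathbb{R})\ \forall c\in\mathcal{C}\}$ and $\mathcal{C}=\{c:\mathbb{R}\to Y\mid f\circ c\in C^\infty(\mathbb{R},\mathbb{R})\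 \forall f\in\mathcal{F}\}$. The associated diffeological space $G(\mathcal{C},Y,\mathcal{F})$ is the set $Y$ whose plots are the maps $p:U\to Y$ with $f\circ p\in C^\infty(U,\mathbb{R})$ for all $f\in\mathcal{F}$. A diffeological space $X$ is called Frölicher if $X=G(\mathcal{C},Y,\mathcal{F})$ for some Frölicher space $(\mathcal{C},Y,\mathcal{F})$. *)

theory Defs
  imports "HOL-Analysis.Analysis" "HOL-Library.FuncSet"
begin

section \<open>Smooth functions on open subsets of Euclidean spaces\<close>

text \<open>
  The dimension \<open>n\<close> has to vary inside the definition of a diffeology, so \<open>\<real>\<^sup>n\<close> is the library's
  \<open>Euclidean_space n\<close>: the sequences \<open>x :: nat \<Rightarrow> real\<close> with \<open>x i = 0\<close> for all \<open>i \<ge> n\<close>.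
  A function on an open set \<open>U\<close> is \<open>C\<^sup>k\<close> if all its iterated partial derivatives of order at
  most \<open>k\<close> exist and are continuous on \<open>U\<close>.  Values outside \<open>U\<close> are irrelevant, because for
  \<open>x \<in> U\<close> and \<open>i < n\<close> the point \<open>x(i := t)\<close> stays in \<open>U\<close> for all \<open>t\<close> near \<open>x i\<close>.
\<close>

definition partial_deriv :: "nat \<Rightarrow> ((nat \<Rightarrow> real) \<Rightarrow> real) \<Rightarrow> (nat \<Rightarrow> real) \<Rightarrow> real" where
  "partial_deriv i f x = deriv (\<lambda>t. f (x(i := t))) (x i)"

primrec Ck_on :: "nat \<Rightarrow> nat \<Rightarrow> (nat \<Rightarrow> real) set \<Rightarrow> ((nat \<Rightarrow> real) \<Rightarrow> real) \<Rightarrow> bool" where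
  "Ck_on 0 n U f \<longleftrightarrow> continuous_on U f"
| "Ck_on (Suc k) n U f \<longleftrightarrow> continuous_on U f \<and>
     (\<forall>i<n. (\<forall>x\<in>U. (\<lambda>t. f (x(i := t))) differentiable (at (x i))) \<and>
            Ck_on k n U (partial_deriv i f))"

definition smooth_on :: "nat \<Rightarrow> (nat \<Rightarrow> real) set \<Rightarrow> ((nat \<Rightarrow> real) \<Rightarrow> real) \<Rightarrow> bool" where
  "smooth_on n U f \<longleftrightarrow> (\<forall>k. Ck_on k n U f)"

definition smooth_map ::
    "nat \<Rightarrow> (nat \<Rightarrow> real) set \<Rightarrow> nat \<Rightarrow> (nat \<Rightarrow> real) set \<Rightarrow> ((nat \<Rightarrow> real) \<Rightarrow> (nat \<Rightarrow> real)) \<Rightarrow> bool"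
  where
  "smooth_map m V n U h \<longleftrightarrow> h \<in> V \<rightarrow> U \<and> (\<forall>j<n. smooth_on m V (\<lambda>x. h x j))"

definition smooth_real :: "(real \<Rightarrow> real) \<Rightarrow> bool" where
  "smooth_real g \<longleftrightarrow> (\<forall>k x. (deriv ^^ k) g differentiable (at x))"


section \<open>Diffeological spaces\<close>

text \<open>
  The underlying set of a space is a type.  A diffeology is given by its set of plots; the triple
  \<open>(n, U, p)\<close> stands for the plot \<open>p : U \<rightarrow> X\<close> with \<open>U\<close> open in \<open>\<real>\<^sup>n\<close>.  Maps \<open>U \<rightarrow> X\<close> are represented
  by extensional functions (arbitrary constant value outside \<open>U\<close>), so that two diffeologies
  have the same plots exactly if they are equal as sets.
\<close>

type_synonym 'a plots = "(nat \<times> (nat \<Rightarrow> real) set \<times> ((nat \<Rightarrow> real) \<Rightarrow> 'a)) set"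

definition diffeology :: "'a plots \<Rightarrow> bool" where
  "diffeology D \<longleftrightarrow>
     (\<forall>(n, U, p) \<in> D. openin (Euclidean_space n) U \<and> p \<in> extensional U) \<and>
     (\<forall>n U c. openin (Euclidean_space n) U \<longrightarrow> (n, U, \<lambda>x\<in>U. c) \<in> D) \<and>
     (\<forall>n U p m V h. (n, U, p) \<in> D \<and> openin (Euclidean_space m) V \<and> smooth_map m V n U h
        \<longrightarrow> (m, V, compose V p h) \<in> D) \<and>
     (\<forall>n U p \<W>. p \<in> extensional U \<and> U = \<Union>\<W> \<and>
        (\<forall>W\<in>\<W>. openin (Euclidean_space n) W \<and> (n, W, restrict p W) \<in> D)
        \<longrightarrow> (n, U, p) \<in> D)"

definition diff_smooth :: "'a plots \<Rightarrow> 'b plots \<Rightarrow> ('a \<Rightarrow> 'b) \<Rightarrow> bool" where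
  "diff_smooth D E f \<longleftrightarrow> (\<forall>(n, U, p) \<in> D. (n, U, compose U f p) \<in> E)"

definition prod_diffeology :: "'a plots \<Rightarrow> 'b plots \<Rightarrow> ('a \<times> 'b) plots" where
  "prod_diffeology D E =
     {(n, U, p). p \<in> extensional U \<and> (n, U, compose U fst p) \<in> D \<and> (n, U, compose U snd p) \<in> E}"

definition real_diffeology :: "real plots" where
  "real_diffeology =
     {(n, U, p). openin (Euclidean_space n) U \<and> p \<in> extensional U \<and> smooth_on n U p}"

definition diffeological_vector_space :: "('a::real_vector) plots \<Rightarrow> bool" where
  "diffeological_vector_space D \<longleftrightarrow> diffeology D \<and>
     diff_smooth (prod_diffeology D D) D (\<lambda>(x, y). x + y) \<and>
     diff_smooth (prod_diffeology real_diffeology D) D (\<lambda>(r, x). r *\<^sub>R x)"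

definition fine_diffeological_vector_space :: "('a::real_vector) plots \<Rightarrow> bool" where
  "fine_diffeological_vector_space D \<longleftrightarrow> diffeological_vector_space D \<and>
     (\<forall>E. diffeological_vector_space E \<longrightarrow> D \<subseteq> E)"

text \<open>A smallest vector space diffeology always exists, so the previous predicate is satisfiable.\<close>

lemma fine_diffeological_vector_space_Inter:
  "fine_diffeological_vector_space (\<Inter>{D :: ('a::real_vector) plots. diffeological_vector_space D})"
    (is "fine_diffeological_vector_space ?I")
proof -
  let ?T = "{(n, U, p). openin (Euclidean_space n) U \<and> p \<in> extensional U} :: 'a plots"
  have T: "diffeological_vector_space ?T"
    unfolding diffeological_vector_space_def
  proof (intro conjI)
    show "diffeology ?T"
      unfolding diffeology_def by (auto intro!: openin_Union)
    show "diff_smooth (prod_diffeology ?T ?T) ?T (\<lambda>(x, y). x + y)"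
      by (auto simp: diff_smooth_def prod_diffeology_def)
    show "diff_smooth (prod_diffeology real_diffeology ?T) ?T (\<lambda>(r, x). r *\<^sub>R x)"
      by (auto simp: diff_smooth_def prod_diffeology_def)
  qed
  have dv: "diffeology D" if "diffeological_vector_space D" for D :: "'a plots"
    using that by (simp add: diffeological_vector_space_def)
  have "diffeology ?I"
    unfolding diffeology_def
  proof (intro conjI)
    show "\<forall>(n, U, p)\<in>?I. openin (Euclidean_space n) U \<and> p \<in> extensional U"
      using T by blast
    show "\<forall>n U c. openin (Euclidean_space n) U \<longrightarrow> (n, U, \<lambda>x\<in>U. c) \<in> ?I"
      using dv by (simp add: diffeology_def)
    show "\<forall>n U p m V h. (n, U, p) \<in> ?I \<and> openin (Euclidean_space m) V \<and> smooth_map m V n U h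
        \<longrightarrow> (m, V, compose V p h) \<in> ?I"
      using dv unfolding diffeology_def by blast
    show "\<forall>n U p \<W>. p \<in> extensional U \<and> U = \<Union>\<W> \<and>
        (\<forall>W\<in>\<W>. openin (Euclidean_space n) W \<and> (n, W, restrict p W) \<in> ?I) \<longrightarrow> (n, U, p) \<in> ?I"
    proof (intro allI impI InterI)
      fix n U and p :: "(nat \<Rightarrow> real) \<Rightarrow> 'a" and \<W> and D :: "'a plots"
      assume a: "p \<in> extensional U \<and> U = \<Union>\<W> \<and>
        (\<forall>W\<in>\<W>. openin (Euclidean_space n) W \<and> (n, W, restrict p W) \<in> ?I)"
        and D: "D \<in> {D. diffeological_vector_space D}"
      from a D have "\<forall>W\<in>\<W>. openin (Euclidean_space n) W \<and> (n, W, restrict p W) \<in> D"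
        by blast
      then show "(n, U, p) \<in> D"
        using a dv[of D] D unfolding diffeology_def by blast
    qed
  qed
  moreover have "diff_smooth (prod_diffeology ?I ?I) ?I (\<lambda>(x, y). x + y)"
    unfolding diff_smooth_def prod_diffeology_def
    by (force simp: diffeological_vector_space_def diff_smooth_def prod_diffeology_def)
  moreover have "diff_smooth (prod_diffeology real_diffeology ?I) ?I (\<lambda>(r, x). r *\<^sub>R x)"
    unfolding diff_smooth_def prod_diffeology_def
    by (force simp: diffeological_vector_space_def diff_smooth_def prod_diffeology_def)
  ultimately show ?thesis
    by (auto simp: fine_diffeological_vector_space_def diffeological_vector_space_def)
qed


section \<open>Froelicher spaces\<close>

definition froelicher_space :: "(real \<Rightarrow> 'a) set \<Rightarrow> ('a \<Rightarrow> real) set \<Rightarrow> bool" where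
  "froelicher_space C F \<longleftrightarrow>
     F = {f. \<forall>c\<in>C. smooth_real (f \<circ> c)} \<and> C = {c. \<forall>f\<in>F. smooth_real (f \<circ> c)}"

text \<open>The plots of the associated diffeological space depend only on the functions \<open>F\<close>.\<close>

definition froelicher_diffeology :: "('a \<Rightarrow> real) set \<Rightarrow> 'a plots" where
  "froelicher_diffeology F =
     {(n, U, p). openin (Euclidean_space n) U \<and> p \<in> extensional U \<and>
        (\<forall>f\<in>F. smooth_on n U (f \<circ> p))}"

definition is_froelicher :: "'a plots \<Rightarrow> bool" where
  "is_froelicher D \<longleftrightarrow> (\<exists>C F. froelicher_space C F \<and> D = froelicher_diffeology F)"

end

theory Submission
  imports Defs
begin

text \<open>
  The functions of the Froelicher structure are forced to be those that are smooth along smooth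
  curves, so for \<open>\<real>\<^sup>n\<close> the theorem is Boman's theorem: a function that is smooth along all smooth
  curves is smooth.  By induction on the order it suffices that a partial derivative of such a
  function is again smooth along smooth curves, which is a statement about \<open>\<partial>\<^sub>s h (0, t)\<close> for a
  function \<open>h\<close> of two variables.  A smooth curve through a rapidly converging sequence shows that all
  \<open>\<partial>\<^sub>s\<^sup>k h\<close> and \<open>\<partial>\<^sub>t\<^sup>k h\<close> are locally bounded.  Hence the difference quotients of \<open>h\<close> in \<open>s\<close> with steps
  \<open>2\<^sup>-\<^sup>j\<close> differ successively by \<open>O(2\<^sup>-\<^sup>j)\<close> while all their \<open>t\<close>-derivatives are \<open>O(2\<^sup>j)\<close>; interpolating between
  these bounds makes every \<open>t\<close>-derivative of the telescoping series converge geometrically.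

  A general fine vector space is reduced to \<open>\<real>\<^sup>n\<close> by the fact that its plots are exactly the maps
  \<open>p\<close> for which \<open>l \<circ> p\<close> is smooth for every linear functional \<open>l\<close>: such a \<open>p\<close> locally takes values in
  a finite-dimensional subspace.
\<close>

section \<open>Smooth functions of one variable\<close>

text \<open>Order \<open>k\<close> means that the derivatives of order up to \<open>k + 1\<close>
  exist. A finite order allows induction for products and composites, whose derivatives bring in
  further functions of the same kind.\<close>

definition diffble_upto :: "nat \<Rightarrow> (real \<Rightarrow> real) \<Rightarrow> bool" where
  "diffble_upto k f \<longleftrightarrow> (\<forall>m\<le>k. \<forall>x. (deriv ^^ m) f differentiable (at x))"

lemma smooth_real_iff_upto: "smooth_real f \<longleftrightarrow> (\<forall>k. diffble_upto k f)"
  by (auto simp: smooth_real_def diffble_upto_def)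

lemma funpow_deriv_Suc: "(deriv ^^ Suc k) f = (deriv ^^ k) (deriv f)"
  by (simp only: funpow_Suc_right o_def)

lemma diffble_upto_Suc:
  "diffble_upto (Suc k) f \<longleftrightarrow> (\<forall>x. f differentiable (at x)) \<and> diffble_upto k (deriv f)"
proof -
  have "(\<forall>m\<le>Suc k. P m) \<longleftrightarrow> P 0 \<and> (\<forall>m\<le>k. P (Suc m))" for P
    by (metis Suc_le_mono le0 not0_implies_Suc)
  from this[of "\<lambda>m. \<forall>x. (deriv ^^ m) f differentiable (at x)"] show ?thesis
    by (simp add: diffble_upto_def funpow_deriv_Suc del: funpow.simps)
qed

lemma diffble_upto_0: "diffble_upto 0 f \<longleftrightarrow> (\<forall>x. f differentiable (at x))"
  by (simp add: diffble_upto_def)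

lemma diffble_upto_D: "diffble_upto k f \<Longrightarrow> f differentiable (at x)"
  unfolding diffble_upto_def by (metis funpow_0 le0)

lemma diffble_upto_DERIV: "diffble_upto k f \<Longrightarrow> (f has_field_derivative deriv f x) (at x)"
  using DERIV_deriv_iff_real_differentiable diffble_upto_D by blast

lemma diffble_upto_Suc_D: "diffble_upto (Suc k) f \<Longrightarrow> diffble_upto k f"
  by (simp add: diffble_upto_def)

lemma smooth_real_diffble: "smooth_real f \<Longrightarrow> f differentiable (at x)"
  using smooth_real_iff_upto diffble_upto_D by blast

lemma smooth_real_DERIV: "smooth_real f \<Longrightarrow> (f has_field_derivative deriv f x) (at x)"
  using DERIV_deriv_iff_real_differentiable smooth_real_diffble by blast

lemma smooth_real_deriv: "smooth_real f \<Longrightarrow> smooth_real (deriv f)"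
  by (metis smooth_real_iff_upto diffble_upto_Suc)

lemma smooth_real_higher_deriv: "smooth_real f \<Longrightarrow> smooth_real ((deriv ^^ k) f)"
  by (induction k) (auto intro: smooth_real_deriv)

lemma smooth_real_higher_DERIV:
  "smooth_real f \<Longrightarrow> ((deriv ^^ k) f has_field_derivative (deriv ^^ Suc k) f x) (at x)"
  using smooth_real_DERIV[OF smooth_real_higher_deriv] by simp

lemma smooth_real_continuous: "smooth_real f \<Longrightarrow> continuous_on S f"
  by (meson DERIV_isCont continuous_at_imp_continuous_on smooth_real_DERIV)

text \<open>Induction on the order of differentiability, over all members of the class at once. It
  serves for families given by a formula that differentiation reproduces, such as
  \<open>flat_fun\<close> and termwise differentiable series.\<close>

lemma smooth_real_coinduct:
  assumes "P f"
    and "\<And>f. P f \<Longrightarrow> (\<forall>x. f differentiable (at x)) \<and> P (deriv f)"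
  shows "smooth_real f"
proof -
  have "P f \<Longrightarrow> diffble_upto k f" for k f
    by (induction k arbitrary: f) (use assms(2) in \<open>auto simp: diffble_upto_0 diffble_upto_Suc\<close>)
  then show ?thesis
    using assms(1) by (simp add: smooth_real_iff_upto)
qed

lemma diffble_upto_cong_deriv:
  assumes "\<And>x. (f has_field_derivative f' x) (at x)"
  shows "diffble_upto (Suc k) f \<longleftrightarrow> diffble_upto k f'"
proof -
  have "deriv f = f'"
    using assms DERIV_imp_deriv by blast
  then show ?thesis
    using assms real_differentiable_def diffble_upto_Suc by auto
qed

section \<open>Closure of smooth functions under the usual operations\<close>

lemma diffble_upto_const: "diffble_upto k (\<lambda>x. c)"
proof (induction k arbitrary: c)
  case (Suc k)
  then show ?case
    using diffble_upto_cong_deriv[of "\<lambda>x. c" "\<lambda>x. 0"] by simp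
qed (simp add: diffble_upto_0)

lemma diffble_upto_ident: "diffble_upto k (\<lambda>x. x)"
proof (cases k)
  case (Suc k)
  then show ?thesis
    using diffble_upto_cong_deriv[of "\<lambda>x. x" "\<lambda>x. 1"] diffble_upto_const by simp
qed (simp add: diffble_upto_0)

lemma diffble_upto_add:
  "diffble_upto k f \<Longrightarrow> diffble_upto k g \<Longrightarrow> diffble_upto k (\<lambda>x. f x + g x)"
proof (induction k arbitrary: f g)
  case (Suc k)
  have "((\<lambda>x. f x + g x) has_field_derivative (deriv f x + deriv g x)) (at x)" for x
    by (intro DERIV_add diffble_upto_DERIV[OF Suc.prems(1)] diffble_upto_DERIV[OF Suc.prems(2)])
  from diffble_upto_cong_deriv[OF this] show ?case
    using Suc by (simp add: diffble_upto_Suc)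
qed (auto simp: diffble_upto_0)

lemma diffble_upto_mult:
  "diffble_upto k f \<Longrightarrow> diffble_upto k g \<Longrightarrow> diffble_upto k (\<lambda>x. f x * g x)"
proof (induction k arbitrary: f g)
  case (Suc k)
  have "((\<lambda>x. f x * g x) has_field_derivative (deriv f x * g x + deriv g x * f x)) (at x)" for x
    by (intro DERIV_mult diffble_upto_DERIV[OF Suc.prems(1)] diffble_upto_DERIV[OF Suc.prems(2)])
  from diffble_upto_cong_deriv[OF this] show ?case
    using Suc diffble_upto_Suc_D by (auto simp: diffble_upto_Suc intro!: diffble_upto_add)
qed (auto simp: diffble_upto_0)

text \<open>The derivative \<open>deriv f (g x) * deriv g x\<close> contains a composite with a new
  outer function of lower order, so the induction ranges over both functions and rests on the
  product case.\<close>

lemma diffble_upto_compose: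
  "diffble_upto k f \<Longrightarrow> diffble_upto k g \<Longrightarrow> diffble_upto k (\<lambda>x. f (g x))"
proof (induction k arbitrary: f g)
  case 0
  then show ?case
    unfolding diffble_upto_0 using DERIV_chain2 real_differentiable_def by metis
next
  case (Suc k)
  have "((\<lambda>x. f (g x)) has_field_derivative (deriv f (g x) * deriv g x)) (at x)" for x
    by (rule DERIV_chain2[OF diffble_upto_DERIV[OF Suc.prems(1)] diffble_upto_DERIV[OF Suc.prems(2)]])
  from diffble_upto_cong_deriv[OF this] show ?case
    using Suc diffble_upto_Suc_D by (auto simp: diffble_upto_Suc intro!: diffble_upto_mult)
qed

lemma smooth_real_const: "smooth_real (\<lambda>x. c)"
  and smooth_real_ident: "smooth_real (\<lambda>x. x)"
  and smooth_real_add: "smooth_real f \<Longrightarrow> smooth_real g \<Longrightarrow> smooth_real (\<lambda>x. f x + g x)"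
  and smooth_real_mult: "smooth_real f \<Longrightarrow> smooth_real g \<Longrightarrow> smooth_real (\<lambda>x. f x * g x)"
  and smooth_real_compose: "smooth_real f \<Longrightarrow> smooth_real g \<Longrightarrow> smooth_real (\<lambda>x. f (g x))"
  by (simp_all add: smooth_real_iff_upto diffble_upto_const diffble_upto_ident diffble_upto_add
      diffble_upto_mult diffble_upto_compose)

lemma smooth_real_diff: "smooth_real f \<Longrightarrow> smooth_real g \<Longrightarrow> smooth_real (\<lambda>x. f x - g x)"
  using smooth_real_add[of f "\<lambda>x. (-1) * g x"] smooth_real_mult[OF smooth_real_const, of g "-1"]
  by simp

lemma smooth_real_divide_const: "smooth_real f \<Longrightarrow> smooth_real (\<lambda>x. f x / c)"
  using smooth_real_mult[OF _ smooth_real_const, of f "1 / c"] by simp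

lemma smooth_real_power: "smooth_real f \<Longrightarrow> smooth_real (\<lambda>x. f x ^ k)"
  by (induction k) (auto intro: smooth_real_const smooth_real_mult)

lemmas smooth_real_intros = smooth_real_const smooth_real_ident smooth_real_add smooth_real_diff
  smooth_real_mult smooth_real_divide_const smooth_real_power

section \<open>Dependence on germs and locality of smoothness\<close>

lemma higher_deriv_cong_ev:
  assumes "eventually (\<lambda>y. f y = g y) (nhds x)"
  shows "eventually (\<lambda>y. (deriv ^^ k) f y = (deriv ^^ k) g y) (nhds x)"
proof (induction k)
  case (Suc k)
  then have "eventually (\<lambda>z. eventually (\<lambda>y. (deriv ^^ k) f y = (deriv ^^ k) g y) (nhds z)) (nhds x)"
    by (simp add: eventually_eventually)
  then show ?case
    by eventually_elim (auto intro: deriv_cong_ev)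
qed (use assms in simp)

lemma higher_deriv_cong_at:
  "eventually (\<lambda>y. f y = g y) (nhds x) \<Longrightarrow> (deriv ^^ k) f x = (deriv ^^ k) g x"
  using higher_deriv_cong_ev eventually_nhds_x_imp_x by blast

text \<open>Functions with the same germ at a point have the same iterated derivatives near it, so
  differentiability of each of these can be checked on a local smooth replacement.\<close>

lemma smooth_real_locally:
  assumes "\<And>x. \<exists>g. smooth_real g \<and> eventually (\<lambda>y. f y = g y) (nhds x)"
  shows "smooth_real f"
  unfolding smooth_real_def
proof (intro allI)
  fix k x
  obtain g where g: "smooth_real g" "eventually (\<lambda>y. f y = g y) (nhds x)"
    using assms by blast
  have "(deriv ^^ k) f differentiable at x \<longleftrightarrow> (deriv ^^ k) g differentiable at x"
    unfolding real_differentiable_def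
    using DERIV_cong_ev[OF refl higher_deriv_cong_ev[OF g(2)] refl] by blast
  then show "(deriv ^^ k) f differentiable at x"
    using g(1) by (simp add: smooth_real_def)
qed

section \<open>Higher derivatives of combinations, affine substitutions and series\<close>

lemma higher_deriv_lincomb:
  assumes "smooth_real f" "smooth_real g"
  shows "(deriv ^^ k) (\<lambda>x. a * f x + b * g x) = (\<lambda>x. a * (deriv ^^ k) f x + b * (deriv ^^ k) g x)"
  using assms
proof (induction k arbitrary: f g)
  case (Suc k)
  have "deriv (\<lambda>x. a * f x + b * g x) = (\<lambda>x. a * deriv f x + b * deriv g x)"
    by (intro ext DERIV_imp_deriv DERIV_add DERIV_cmult smooth_real_DERIV Suc.prems)
  then show ?case
    using Suc by (simp add: funpow_deriv_Suc smooth_real_deriv del: funpow.simps)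
qed simp

lemma higher_deriv_affine:
  assumes "smooth_real f"
  shows "(deriv ^^ k) (\<lambda>x. f (a + b * x)) = (\<lambda>x. b ^ k * (deriv ^^ k) f (a + b * x))"
  using assms
proof (induction k arbitrary: f)
  case (Suc k)
  have "((\<lambda>x. a + b * x) has_field_derivative b) (at x)" for x
    by (auto intro!: derivative_eq_intros)
  \<comment> \<open>The summand \<open>0 * 0\<close> gives the right-hand side the shape of
    \<open>higher_deriv_lincomb\<close> with the constant 0 as second function.\<close>
  from DERIV_chain2[OF smooth_real_DERIV[OF Suc.prems] this]
  have 1: "deriv (\<lambda>x. f (a + b * x)) = (\<lambda>x. b * deriv f (a + b * x) + 0 * 0)"
    by (intro ext DERIV_imp_deriv) (simp add: mult.commute)
  have "smooth_real (\<lambda>x. deriv f (a + b * x))"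
    by (intro smooth_real_compose[OF smooth_real_deriv[OF Suc.prems]] smooth_real_intros)
  from higher_deriv_lincomb[OF this smooth_real_const[of 0], of k b 0]
  show ?case
    unfolding funpow_deriv_Suc 1 using Suc.IH[OF smooth_real_deriv[OF Suc.prems]] 
    by (simp add: funpow_deriv_Suc mult_ac del: funpow.simps)
qed simp

lemma higher_deriv_const: "(deriv ^^ Suc k) (\<lambda>x. c) = (\<lambda>x. 0 :: real)"
proof (induction k)
  case (Suc k)
  then have "deriv ((deriv ^^ Suc k) (\<lambda>x. c)) = deriv (\<lambda>x. 0 :: real)"
    by simp
  then show ?case
    by simp
qed (auto intro: DERIV_imp_deriv)

text \<open>The Weierstrass test for the first derivatives permits termwise differentiation. The
  series of derivatives satisfies the same assumptions with \<open>k\<close> shifted by one, so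
  coinduction applies.\<close>

lemma smooth_real_suminf:
  fixes f :: "nat \<Rightarrow> real \<Rightarrow> real"
  assumes "\<And>j. smooth_real (f j)"
    and "\<And>k. \<exists>M. summable M \<and> (\<forall>j x. \<bar>(deriv ^^ k) (f j) x\<bar> \<le> M j)"
  shows "smooth_real (\<lambda>x. \<Sum>j. f j x)"
proof -
  define P where "P = (\<lambda>g. \<exists>f :: nat \<Rightarrow> real \<Rightarrow> real. g = (\<lambda>x. \<Sum>j. f j x) \<and> (\<forall>j. smooth_real (f j)) \<and>
    (\<forall>k. \<exists>M. summable M \<and> (\<forall>j x. \<bar>(deriv ^^ k) (f j) x\<bar> \<le> M j)))"
  show ?thesis
  proof (rule smooth_real_coinduct[of P])
    show "P (\<lambda>x. \<Sum>j. f j x)"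
      unfolding P_def using assms by blast
  next
    fix g assume "P g"
    then obtain f where g: "g = (\<lambda>x. \<Sum>j. f j x)" and f: "\<And>j. smooth_real (f j)"
      and b: "\<And>k. \<exists>M. summable M \<and> (\<forall>j x. \<bar>(deriv ^^ k) (f j) x\<bar> \<le> M j)"
      unfolding P_def by metis
    have 1: "uniformly_convergent_on UNIV (\<lambda>n x. \<Sum>i<n. deriv (f i) x)"
    proof -
      obtain M where "summable M" "\<forall>j x. \<bar>deriv (f j) x\<bar> \<le> M j"
        using b[of 1] by auto
      then show ?thesis
        by (intro Weierstrass_m_test') auto
    qed
    have 2: "summable (\<lambda>n. f n x)" for x
    proof -
      obtain M where "summable M" "\<forall>j x. \<bar>f j x\<bar> \<le> M j"
        using b[of 0] by auto
      then show ?thesis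
        by (metis summable_comparison_test' real_norm_def)
    qed
    have 3: "(g has_field_derivative (\<Sum>n. deriv (f n) x)) (at x)" for x
      unfolding g using has_field_derivative_series'(2)[of UNIV f "\<lambda>n. deriv (f n)" 0 x]
        1 2 smooth_real_DERIV[OF f] by simp
    then have "deriv g = (\<lambda>x. \<Sum>n. deriv (f n) x)"
      using DERIV_imp_deriv by blast
    moreover have "\<exists>M. summable M \<and> (\<forall>j x. \<bar>(deriv ^^ k) (deriv (f j)) x\<bar> \<le> M j)" for k
      using b[of "Suc k"] unfolding funpow_deriv_Suc .
    ultimately have "P (deriv g)"
      unfolding P_def using f smooth_real_deriv by (intro exI[of _ "\<lambda>j. deriv (f j)"]) simp
    then show "(\<forall>x. g differentiable (at x)) \<and> P (deriv g)"
      using 3 real_differentiable_def by blast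
  qed
qed

section \<open>A bump function\<close>

text \<open>The standard flat function \<open>exp (- (1 / x))\<close>, extended by 0. The polynomial
  in \<open>1 / x\<close> makes the family closed under differentiation.\<close>

definition flat_fun :: "real poly \<Rightarrow> real \<Rightarrow> real" where
  "flat_fun P x = (if x > 0 then poly P (1 / x) * exp (- (1 / x)) else 0)"

lemma poly_exp_tendsto_0: "((\<lambda>x. poly P x * exp (- x)) \<longlongrightarrow> (0::real)) at_top"
proof -
  have "((\<lambda>x. \<Sum>i\<le>degree P. coeff P i * (x ^ i / exp x)) \<longlongrightarrow> (\<Sum>i\<le>degree P. coeff P i * 0)) at_top"
    by (intro tendsto_intros tendsto_power_div_exp_0)
  moreover have "(\<Sum>i\<le>degree P. coeff P i * (x ^ i / exp x)) = poly P x * exp (- x)" for x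
    by (simp add: poly_altdef sum_distrib_left exp_minus divide_inverse mult_ac)
  ultimately show ?thesis
    by simp
qed

lemma DERIV_transform_ev:
  "eventually (\<lambda>y. f y = g y) (nhds x) \<Longrightarrow> (g has_field_derivative D) (at x)
    \<Longrightarrow> (f has_field_derivative D) (at x)"
  using DERIV_cong_ev[of x x f g D D] by simp

text \<open>For positive \<open>x\<close>, differentiating \<open>1 / x\<close> produces the factor
  \<open>1 / x\<close> squared, that is \<open>[:0, 0, 1:]\<close>, and the product rule leaves
  \<open>P - pderiv P\<close>. At 0 exponential decay beats every polynomial.\<close>

lemma flat_fun_DERIV:
  "(flat_fun P has_field_derivative flat_fun ([:0, 0, 1:] * (P - pderiv P)) x) (at x)"
proof -
  consider "x > 0" | "x < 0" | "x = 0" by linarith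
  then show ?thesis
  proof cases
    case 1
    have "((\<lambda>x. poly P (1 / x) * exp (- (1 / x))) has_field_derivative
        flat_fun ([:0, 0, 1:] * (P - pderiv P)) x) (at x)"
      unfolding flat_fun_def using 1
      by (auto intro!: derivative_eq_intros simp: field_simps power2_eq_square)
    moreover have "eventually (\<lambda>y. flat_fun P y = poly P (1 / y) * exp (- (1 / y))) (nhds x)"
      using eventually_nhds_in_open[of "{0<..}" x] 1
      by (auto simp: flat_fun_def elim!: eventually_mono)
    ultimately show ?thesis
      by (rule DERIV_transform_ev[rotated])
  next
    case 2
    have "eventually (\<lambda>y. flat_fun P y = 0) (nhds x)"
      using eventually_nhds_in_open[of "{..<0}" x] 2
      by (auto simp: flat_fun_def elim!: eventually_mono)
    moreover have "((\<lambda>x. 0) has_field_derivative flat_fun ([:0, 0, 1:] * (P - pderiv P)) x) (at x)"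
      using 2 by (simp add: flat_fun_def)
    ultimately show ?thesis
      by (rule DERIV_transform_ev)
  next
    case 3
    have "((\<lambda>y. flat_fun P y / y) \<longlongrightarrow> 0) (at_right 0)"
    proof -
      \<comment> \<open>The extra factor \<open>[:0, 1:]\<close>, evaluated at
        \<open>inverse y\<close>, absorbs the division by \<open>y\<close> in the difference
        quotient.\<close>
      have "((\<lambda>y. poly ([:0, 1:] * P) (inverse y) * exp (- inverse y)) \<longlongrightarrow> 0) (at_right (0::real))"
        by (rule filterlim_compose[OF poly_exp_tendsto_0 filterlim_inverse_at_top_right])
      moreover have "eventually (\<lambda>y. poly ([:0, 1:] * P) (inverse y) * exp (- inverse y)
          = flat_fun P y / y) (at_right (0::real))"
        using eventually_at_right_less[of "0::real"]
        by eventually_elim (simp add: flat_fun_def divide_inverse mult_ac)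
      ultimately show ?thesis
        using Lim_transform_eventually by fastforce
    qed
    moreover have "((\<lambda>y. flat_fun P y / y) \<longlongrightarrow> 0) (at_left 0)"
      by (rule tendsto_eventually)
        (auto simp: flat_fun_def eventually_at_left_field intro!: exI[of _ "-1"])
    ultimately have "((\<lambda>y. flat_fun P y / y) \<longlongrightarrow> 0) (at 0)"
      by (simp add: filterlim_split_at_real)
    then show ?thesis
      using 3 by (simp add: has_field_derivative_iff flat_fun_def)
  qed
qed

lemma smooth_real_flat_fun: "smooth_real (flat_fun P)"
proof (rule smooth_real_coinduct[of "\<lambda>f. \<exists>P. f = flat_fun P"])
  fix f :: "real \<Rightarrow> real" assume "\<exists>P. f = flat_fun P"
  then obtain P where "f = flat_fun P" by blast
  then show "(\<forall>x. f differentiable (at x)) \<and> (\<exists>P. deriv f = flat_fun P)"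
    using flat_fun_DERIV[of P] DERIV_imp_deriv real_differentiable_def by blast
qed blast

text \<open>The inner function vanishes for \<open>\<bar>x\<bar> \<le> 1/2\<close> and is at least \<open>exp (- 4 / 3)\<close> for
  \<open>\<bar>x\<bar> \<ge> 1\<close>.\<close>

definition bump :: "real \<Rightarrow> real" where
  "bump x = exp 1 * flat_fun 1 (1 - exp (4 / 3) * flat_fun 1 (x\<^sup>2 - 1 / 4))"

lemma smooth_real_bump: "smooth_real bump"
  unfolding bump_def
  by (intro smooth_real_intros smooth_real_compose[OF smooth_real_flat_fun])

text \<open>The inner argument \<open>x\<^sup>2 - 1 / 4\<close> is at most 0, so the outer
  \<open>flat_fun 1\<close> is evaluated at 1, where its value \<open>exp (- 1)\<close> is cancelled
  by the factor \<open>exp 1\<close>.\<close>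

lemma bump_eq_1: "\<bar>x\<bar> \<le> 1 / 2 \<Longrightarrow> bump x = 1"
proof -
  assume "\<bar>x\<bar> \<le> 1 / 2"
  then have "x\<^sup>2 \<le> (1 / 2)\<^sup>2"
    by (metis abs_le_square_iff abs_of_nonneg zero_le_divide_1_iff zero_le_numeral)
  then show ?thesis
    by (simp add: bump_def flat_fun_def power2_eq_square flip: exp_add)
qed

text \<open>The factor \<open>exp (4 / 3)\<close> compensates the least value of the inner function
  on this range, so the outer argument is at most 0.\<close>

lemma bump_eq_0: "\<bar>x\<bar> \<ge> 1 \<Longrightarrow> bump x = 0"
proof -
  assume "\<bar>x\<bar> \<ge> 1"
  then have x: "x\<^sup>2 \<ge> 1"
    using abs_le_square_iff[of 1 x] by simp
  then have "1 / (x\<^sup>2 - 1 / 4) \<le> 4 / 3"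
    by (simp add: field_simps)
  then have "exp (4 / 3) * flat_fun 1 (x\<^sup>2 - 1 / 4) \<ge> 1"
    using x by (simp add: flat_fun_def flip: exp_add)
  then show ?thesis
    by (simp add: bump_def flat_fun_def)
qed

lemma bump_bound: "\<bar>bump x\<bar> \<le> 1"
proof -
  define y where "y = 1 - exp (4 / 3) * flat_fun 1 (x\<^sup>2 - 1 / 4)"
  have "flat_fun 1 (x\<^sup>2 - 1 / 4) \<ge> 0"
    by (simp add: flat_fun_def)
  then have "y \<le> 1"
    by (simp add: y_def)
  then have "\<bar>exp 1 * flat_fun 1 y\<bar> \<le> 1"
    by (auto simp: flat_fun_def abs_mult field_simps simp flip: exp_add)
  then show ?thesis
    by (simp add: bump_def y_def)
qed

text \<open>Maps the line smoothly into the interval from \<open>-r\<close> to \<open>r\<close> and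
  is the identity near 0. Reparametrizing a curve by it confines the curve to a short arc without
  changing its germ.\<close>

definition cutoff :: "real \<Rightarrow> real \<Rightarrow> real" where
  "cutoff r x = x * bump (x / r)"

lemma smooth_real_cutoff: "smooth_real (cutoff r)"
  unfolding cutoff_def by (intro smooth_real_intros smooth_real_compose[OF smooth_real_bump])

lemma cutoff_eq: "\<bar>x\<bar> \<le> r / 2 \<Longrightarrow> cutoff r x = x"
  by (cases "r > 0") (auto simp: cutoff_def intro!: bump_eq_1)

lemma cutoff_eq_0: "r > 0 \<Longrightarrow> \<bar>x\<bar> \<ge> r \<Longrightarrow> cutoff r x = 0"
  by (auto simp: cutoff_def intro!: bump_eq_0)

lemma cutoff_bound: "r > 0 \<Longrightarrow> \<bar>cutoff r x\<bar> \<le> r"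
proof (cases "\<bar>x\<bar> \<ge> r")
  case False
  then have "\<bar>x\<bar> * \<bar>bump (x / r)\<bar> \<le> r * 1"
    using bump_bound by (intro mult_mono) auto
  then show ?thesis
    by (simp add: cutoff_def abs_mult)
qed (auto simp: cutoff_eq_0)

section \<open>Smooth curves through rapidly converging sequences\<close>

text \<open>Compactness bounds the continuous derivative on the interval. The complement is open, so
  outside the interval \<open>f\<close> vanishes on a neighbourhood and its derivatives vanish
  too.\<close>

lemma higher_deriv_bounded:
  assumes "smooth_real f" "\<And>x. \<bar>x - x0\<bar> \<ge> R \<Longrightarrow> f x = 0"
  shows "\<exists>K. \<forall>x. \<bar>(deriv ^^ k) f x\<bar> \<le> K"
proof -
  have "continuous_on {x0 - R..x0 + R} ((deriv ^^ k) f)"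
    by (intro smooth_real_continuous smooth_real_higher_deriv assms(1))
  then have "bounded ((deriv ^^ k) f ` {x0 - R..x0 + R})"
    using compact_continuous_image compact_imp_bounded by blast
  then obtain K where K: "\<And>x. x \<in> {x0 - R..x0 + R} \<Longrightarrow> \<bar>(deriv ^^ k) f x\<bar> \<le> K"
    unfolding bounded_iff by (metis image_eqI real_norm_def)
  have "(deriv ^^ k) f x = 0" if "x \<notin> {x0 - R..x0 + R}" for x
  proof -
    have "eventually (\<lambda>y. y \<in> - {x0 - R..x0 + R}) (nhds x)"
      using that by (intro eventually_nhds_in_open) auto
    then have "eventually (\<lambda>y. f y = 0) (nhds x)"
      by eventually_elim (use assms(2) in force)
    then have "(deriv ^^ k) f x = (deriv ^^ k) (\<lambda>_. 0) x"
      by (rule higher_deriv_cong_at)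
    also have "\<dots> = 0"
      by (cases k) (simp_all only: higher_deriv_const funpow_0)
    finally show ?thesis .
  qed
  then have "\<bar>(deriv ^^ k) f x\<bar> \<le> max K 0" for x
    using K[of x] by (cases "x \<in> {x0 - R..x0 + R}") auto
  then show ?thesis
    by blast
qed

text \<open>The nodes \<open>T j\<close> and tolerances \<open>l j\<close> are fixed before the
  data, so sequences can first be thinned out to meet the tolerances. The curve is a sum of
  disjointly supported bumps; being affine near each node, it lets higher derivatives along lines be
  read off.\<close>

lemma smooth_curve_through_sequences:
  obtains T l :: "nat \<Rightarrow> real" where "T \<longlonglongrightarrow> 0" "\<forall>j. l j > 0"
    "\<forall>y z. (\<forall>j. \<bar>y j\<bar> \<le> l j) \<longrightarrow> (\<forall>j. \<bar>z j\<bar> \<le> l j) \<longrightarrow>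
       (\<exists>c. smooth_real c \<and> c 0 = 0 \<and>
         (\<forall>j. eventually (\<lambda>x. c x = y j + z j * (x - T j)) (nhds (T j))))"
proof -
  define T where "T = (\<lambda>j. (1 / 2 :: real) ^ j)"
  \<comment> \<open>The radius is small against the gaps between the nodes, so the supports are
    pairwise disjoint and avoid 0.\<close>
  define r where "r = (\<lambda>j. T j / 8)"
  have Tpos: "T j > 0" for j by (simp add: T_def)
  have rpos: "r j > 0" for j by (simp add: r_def Tpos)
  have T_less: "T j \<le> T i / 2" if "i < j" for i j
  proof -
    have "T j \<le> T (Suc i)"
      unfolding T_def using that by (intro power_decreasing) auto
    then show ?thesis by (simp add: T_def)
  qed
  \<comment> \<open>Near the node \<open>b1 j\<close> is 1 and \<open>b2 j\<close> is
    \<open>x - T j\<close>: they carry the prescribed value and slope.\<close>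
  define b1 where "b1 = (\<lambda>j x. bump ((x - T j) / r j))"
  define b2 where "b2 = (\<lambda>j x. cutoff (r j) (x - T j))"
  have sm1: "smooth_real (b1 j)" and sm2: "smooth_real (b2 j)" for j
    unfolding b1_def b2_def
    by (intro smooth_real_compose[OF smooth_real_bump] smooth_real_compose[OF smooth_real_cutoff]
        smooth_real_intros)+
  have far: "b1 j x = 0" "b2 j x = 0" if "\<bar>x - T j\<bar> \<ge> r j" for j x
    using that rpos[of j] by (auto simp: b1_def b2_def cutoff_eq_0 intro!: bump_eq_0)
  have near: "b1 j x = 1" "b2 j x = x - T j" if "\<bar>x - T j\<bar> \<le> r j / 2" for j x
    using that rpos[of j] by (auto simp: b1_def b2_def cutoff_eq intro!: bump_eq_1)
  have "\<exists>K. \<forall>x. \<bar>(deriv ^^ k) (b1 j) x\<bar> \<le> K \<and> \<bar>(deriv ^^ k) (b2 j) x\<bar> \<le> K" for j k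
  proof -
    obtain K1 K2 where "\<forall>x. \<bar>(deriv ^^ k) (b1 j) x\<bar> \<le> K1" "\<forall>x. \<bar>(deriv ^^ k) (b2 j) x\<bar> \<le> K2"
      using higher_deriv_bounded[OF sm1[of j] far(1)[of j], where k = k]
        higher_deriv_bounded[OF sm2[of j] far(2)[of j], where k = k] by blast
    then show ?thesis
      by (intro exI[of _ "max K1 K2"]) (auto simp: le_max_iff_disj)
  qed
  then have "\<exists>K. \<forall>j k. \<forall>x. \<bar>(deriv ^^ k) (b1 j) x\<bar> \<le> K j k \<and> \<bar>(deriv ^^ k) (b2 j) x\<bar> \<le> K j k"
    by (intro choice allI)
  then obtain K where K: "\<bar>(deriv ^^ k) (b1 j) x\<bar> \<le> K j k"
      "\<bar>(deriv ^^ k) (b2 j) x\<bar> \<le> K j k" for j k x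
    by blast
  have K0: "K j k \<ge> 0" for j k
    using K(1)[of k j 0] by linarith
  \<comment> \<open>A diagonal choice: the sum over \<open>k \<le> j\<close> makes the
    \<open>k\<close>-th derivative of the \<open>j\<close>-th summand at most \<open>T j\<close> as
    soon as \<open>j \<ge> k\<close>.\<close>
  define l where "l = (\<lambda>j. T j / (1 + 2 * (\<Sum>k\<le>j. K j k)))"
  have S0: "(\<Sum>k\<le>j. K j k) \<ge> 0" for j
    by (intro sum_nonneg K0)
  have lpos: "l j > 0" for j
    using S0[of j] by (auto simp: l_def Tpos intro!: divide_pos_pos)
  have lK: "2 * l j * K j k \<le> T j" if "k \<le> j" for j k
  proof -
    have "K j k \<le> (\<Sum>k\<le>j. K j k)"
      using that K0 by (intro member_le_sum) auto
    then have "2 * K j k \<le> 1 + 2 * (\<Sum>k\<le>j. K j k)"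
      by linarith
    then have "l j * (2 * K j k) \<le> l j * (1 + 2 * (\<Sum>k\<le>j. K j k))"
      using lpos[of j] by (intro mult_left_mono) auto
    also have "\<dots> = T j"
      using S0[of j] by (simp add: l_def)
    finally show ?thesis by (simp add: mult_ac)
  qed
  have curve: "\<exists>c. smooth_real c \<and> c 0 = 0 \<and>
         (\<forall>j. eventually (\<lambda>x. c x = y j + z j * (x - T j)) (nhds (T j)))"
    if yz: "\<And>j. \<bar>y j\<bar> \<le> l j" "\<And>j. \<bar>z j\<bar> \<le> l j" for y z
  proof -
    define f where "f = (\<lambda>j x. y j * b1 j x + z j * b2 j x)"
    define c where "c = (\<lambda>x. \<Sum>j. f j x)"
    have "smooth_real c"
      unfolding c_def
    proof (rule smooth_real_suminf)
      show "smooth_real (f j)" for j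
        unfolding f_def by (intro smooth_real_intros sm1 sm2)
      fix k
      \<comment> \<open>Only the finitely many indices below \<open>k\<close> escape the bound
        \<open>T j\<close>, and these do not affect summability.\<close>
      define M where "M = (\<lambda>j. if k \<le> j then T j else 2 * l j * K j k)"
      have "summable T"
        unfolding T_def by (intro summable_geometric) simp
      moreover have "eventually (\<lambda>j. M j = T j) sequentially"
        using eventually_ge_at_top[of k] by eventually_elim (simp add: M_def)
      ultimately have "summable M"
        by (simp add: summable_cong)
      moreover have "\<bar>(deriv ^^ k) (f j) x\<bar> \<le> M j" for j x
      proof -
        have "\<bar>(deriv ^^ k) (f j) x\<bar> = \<bar>y j * (deriv ^^ k) (b1 j) x + z j * (deriv ^^ k) (b2 j) x\<bar>"
          unfolding f_def by (simp add: higher_deriv_lincomb[OF sm1 sm2])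
        also have "\<dots> \<le> \<bar>y j\<bar> * \<bar>(deriv ^^ k) (b1 j) x\<bar> + \<bar>z j\<bar> * \<bar>(deriv ^^ k) (b2 j) x\<bar>"
          by (metis abs_mult abs_triangle_ineq)
        also have "\<dots> \<le> l j * K j k + l j * K j k"
          using lpos[of j] K0 by (intro add_mono mult_mono K yz) auto
        also have "\<dots> \<le> M j"
          using lK[of k j] by (auto simp: M_def)
        finally show ?thesis .
      qed
      ultimately show "\<exists>M. summable M \<and> (\<forall>j x. \<bar>(deriv ^^ k) (f j) x\<bar> \<le> M j)"
        by blast
    qed
    moreover have "c 0 = 0"
    proof -
      have "f j 0 = 0" for j
        using far[of j 0] Tpos[of j] by (simp add: f_def r_def)
      then show ?thesis by (simp add: c_def)
    qed
    moreover have "eventually (\<lambda>x. c x = y j + z j * (x - T j)) (nhds (T j))" for j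
    proof -
      have "eventually (\<lambda>x. x \<in> {T j - r j / 2<..<T j + r j / 2}) (nhds (T j))"
        using rpos[of j] by (intro eventually_nhds_in_open) auto
      then show ?thesis
      proof eventually_elim
        case (elim x)
        then have x: "\<bar>x - T j\<bar> \<le> r j / 2"
          unfolding greaterThanLessThan_iff by linarith
        have "f i x = 0" if "i \<noteq> j" for i
        proof -
          have "r i \<le> \<bar>x - T i\<bar>"
            using that x T_less[of i j] T_less[of j i] Tpos[of i] Tpos[of j]
            unfolding r_def by (cases "i < j"; cases "j < i"; simp only: simp_thms) linarith+
          then show ?thesis
            using far[of i x] by (simp add: f_def)
        qed
        then have "c x = (\<Sum>i\<in>{j}. f i x)"
          unfolding c_def by (intro suminf_finite) auto
        then show ?case
          using near[OF x] by (simp add: f_def)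
      qed
    qed
    ultimately show ?thesis
      by blast
  qed
  have "T \<longlonglongrightarrow> 0"
    unfolding T_def by (intro LIMSEQ_power_zero) simp
  with curve lpos show thesis
    by (intro that[of T l]) auto
qed

section \<open>Interpolation of derivative bounds\<close>

lemma DERIV_bound_lipschitz:
  fixes f :: "real \<Rightarrow> real"
  assumes "convex S" "\<And>x. x \<in> S \<Longrightarrow> (f has_field_derivative f' x) (at x)"
    and "\<And>x. x \<in> S \<Longrightarrow> \<bar>f' x\<bar> \<le> B" "x \<in> S" "y \<in> S"
  shows "\<bar>f x - f y\<bar> \<le> B * \<bar>x - y\<bar>"
proof -
  have "norm (f x - f y) \<le> B * norm (x - y)"
    by (rule field_differentiable_bound[where f' = f' and S = S])
      (simp_all add: assms has_field_derivative_at_within)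
  then show ?thesis
    by simp
qed

text \<open>The \<open>k\<close>-th finite difference of \<open>u\<close> with step \<open>d\<close>
  is bounded by \<open>2 ^ k * A\<close>, and by repeated use of the mean value theorem it is
  \<open>d ^ k\<close> times the \<open>k\<close>-th derivative at an intermediate point.\<close>

lemma ex_small_higher_deriv:
  assumes "smooth_real u" "\<And>x. \<bar>u x\<bar> \<le> A" "d > 0"
  shows "\<exists>\<xi>. \<bar>\<xi> - x\<bar> \<le> real k * d \<and> d ^ k * \<bar>(deriv ^^ k) u \<xi>\<bar> \<le> 2 ^ k * A"
  using assms(1,2)
proof (induction k arbitrary: u A)
  case 0
  then show ?case by (intro exI[of _ x]) simp
next
  case (Suc k)
  \<comment> \<open>The argument is written \<open>d + 1 * y\<close> to fit
    \<open>higher_deriv_affine\<close>.\<close>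
  define v where "v = (\<lambda>y. u (d + 1 * y) - u y)"
  have sv: "smooth_real (\<lambda>y. u (d + 1 * y))"
    by (intro smooth_real_compose[OF Suc.prems(1)] smooth_real_intros)
  have "smooth_real v"
    unfolding v_def by (intro smooth_real_intros sv Suc.prems)
  moreover have "\<bar>v y\<bar> \<le> 2 * A" for y
    using Suc.prems(2)[of "d + 1 * y"] Suc.prems(2)[of y] unfolding v_def by linarith
  ultimately obtain \<xi> where \<xi>: "\<bar>\<xi> - x\<bar> \<le> real k * d" "d ^ k * \<bar>(deriv ^^ k) v \<xi>\<bar> \<le> 2 ^ k * (2 * A)"
    using Suc.IH by blast
  have "(deriv ^^ k) v \<xi> = (deriv ^^ k) u (d + \<xi>) - (deriv ^^ k) u \<xi>"
    using higher_deriv_lincomb[OF sv Suc.prems(1), of k 1 "-1"]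
      higher_deriv_affine[OF Suc.prems(1), of k d 1] by (simp add: v_def)
  moreover obtain z where z: "\<xi> < z" "z < d + \<xi>"
    "(deriv ^^ k) u (d + \<xi>) - (deriv ^^ k) u \<xi> = (d + \<xi> - \<xi>) * (deriv ^^ Suc k) u z"
    using MVT2[of \<xi> "d + \<xi>" "(deriv ^^ k) u" "(deriv ^^ Suc k) u"] \<open>d > 0\<close>
      smooth_real_higher_DERIV[OF Suc.prems(1)] by auto
  ultimately have "\<bar>(deriv ^^ k) v \<xi>\<bar> = d * \<bar>(deriv ^^ Suc k) u z\<bar>"
    using \<open>d > 0\<close> by (simp add: abs_mult)
  then have "d ^ Suc k * \<bar>(deriv ^^ Suc k) u z\<bar> \<le> 2 ^ Suc k * A"
    using \<xi>(2) by (simp add: mult_ac)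
  moreover have "\<bar>z - x\<bar> \<le> real (Suc k) * d"
    using \<xi>(1) z by (simp add: algebra_simps)
  ultimately show ?case
    by blast
qed

text \<open>A point within \<open>k * d\<close> where the \<open>k\<close>-th derivative is small
  exists, and the bound on the next derivative controls the change on the way to
  \<open>x\<close>.\<close>

lemma higher_deriv_interpolation_step:
  assumes "smooth_real u" "\<And>x. \<bar>u x\<bar> \<le> A" "d > 0" "\<And>x. \<bar>(deriv ^^ Suc k) u x\<bar> \<le> B"
  shows "\<bar>(deriv ^^ k) u x\<bar> \<le> 2 ^ k * A / d ^ k + real k * d * B"
proof -
  obtain \<xi> where \<xi>: "\<bar>\<xi> - x\<bar> \<le> real k * d" "d ^ k * \<bar>(deriv ^^ k) u \<xi>\<bar> \<le> 2 ^ k * A"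
    using ex_small_higher_deriv assms(1-3) by blast
  have "B \<ge> 0"
    using assms(4)[of 0] by linarith
  have "\<bar>(deriv ^^ k) u x - (deriv ^^ k) u \<xi>\<bar> \<le> B * \<bar>x - \<xi>\<bar>"
    by (rule DERIV_bound_lipschitz[of UNIV _ "(deriv ^^ Suc k) u"])
      (auto intro: smooth_real_higher_DERIV[OF assms(1)] assms(4) simp del: funpow.simps)
  also have "\<dots> \<le> B * (real k * d)"
    using \<xi>(1) \<open>B \<ge> 0\<close> by (intro mult_left_mono) auto
  finally have "\<bar>(deriv ^^ k) u x\<bar> \<le> \<bar>(deriv ^^ k) u \<xi>\<bar> + real k * d * B"
    by (simp add: mult_ac)
  moreover have "\<bar>(deriv ^^ k) u \<xi>\<bar> \<le> 2 ^ k * A / d ^ k"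
    using \<xi>(2) \<open>d > 0\<close> by (simp add: field_simps)
  ultimately show ?thesis
    by linarith
qed

text \<open>A Landau-Kolmogorov inequality with the scale \<open>d\<close> left free;
  \<open>C\<close> depends only on \<open>k\<close> and \<open>j\<close>. The order
  \<open>k + 1\<close> with gap \<open>j\<close> is bounded first, and one interpolation step then
  descends to order \<open>k\<close>.\<close>

lemma higher_deriv_interpolation:
  "\<exists>C\<ge>0. \<forall>u A B d x. smooth_real u \<longrightarrow> (\<forall>x. \<bar>u x\<bar> \<le> A) \<longrightarrow> d > 0 \<longrightarrow>
     (\<forall>x. \<bar>(deriv ^^ (k + j)) u x\<bar> \<le> B) \<longrightarrow> \<bar>(deriv ^^ k) u x\<bar> \<le> C * (A / d ^ k + d ^ j * B)"
proof (induction j arbitrary: k)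
  case 0
  have "\<bar>(deriv ^^ k) u x\<bar> \<le> 1 * (A / d ^ k + d ^ 0 * B)"
    if "\<forall>x. \<bar>u x\<bar> \<le> A" "d > 0" "\<forall>x. \<bar>(deriv ^^ (k + 0)) u x\<bar> \<le> B" for u :: "real \<Rightarrow> real" and A B d x
  proof -
    have "A \<ge> 0"
      using that(1)[rule_format, of 0] by linarith
    then have "A / d ^ k \<ge> 0"
      using that(2) by simp
    then show ?thesis
      using that(3)[rule_format, of x] by simp
  qed
  then show ?case
    by (intro exI[of _ 1]) auto
next
  case (Suc j)
  obtain C where C: "C \<ge> 0" and *: "\<And>u A B d x. smooth_real u \<Longrightarrow> (\<forall>x. \<bar>u x\<bar> \<le> A) \<Longrightarrow> d > 0 \<Longrightarrow>
     (\<forall>x. \<bar>(deriv ^^ (Suc k + j)) u x\<bar> \<le> B) \<Longrightarrow>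
     \<bar>(deriv ^^ Suc k) u x\<bar> \<le> C * (A / d ^ Suc k + d ^ j * B)"
    using Suc.IH[of "Suc k"] by blast
  have "\<bar>(deriv ^^ k) u x\<bar> \<le> (2 ^ k + real k * C) * (A / d ^ k + d ^ Suc j * B)"
    if u: "smooth_real u" "\<forall>x. \<bar>u x\<bar> \<le> A" "d > 0" "\<forall>x. \<bar>(deriv ^^ (k + Suc j)) u x\<bar> \<le> B"
    for u :: "real \<Rightarrow> real" and A B d x
  proof -
    have B: "B \<ge> 0"
      using u(4)[rule_format, of 0] by linarith
    have "\<bar>(deriv ^^ Suc k) u x\<bar> \<le> C * (A / d ^ Suc k + d ^ j * B)" for x
      using * u by simp
    from higher_deriv_interpolation_step[OF u(1) _ u(3) this, of A x] u(2)
    have "\<bar>(deriv ^^ k) u x\<bar> \<le> 2 ^ k * A / d ^ k + real k * d * (C * (A / d ^ Suc k + d ^ j * B))"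
      by simp
    also have "\<dots> = 2 ^ k * (A / d ^ k) + real k * C * (A / d ^ k + d ^ Suc j * B)"
      using \<open>d > 0\<close> by (simp add: field_simps)
    also have "\<dots> \<le> 2 ^ k * (A / d ^ k + d ^ Suc j * B) + real k * C * (A / d ^ k + d ^ Suc j * B)"
      using B \<open>d > 0\<close> by (intro add_right_mono mult_left_mono) auto
    finally show ?thesis
      by (simp add: algebra_simps)
  qed
  then show ?case
    using C by (intro exI[of _ "2 ^ k + real k * C"]) auto
qed

text \<open>Interpolation at the scale \<open>d = \<rho> ^ i\<close>, shrinking slowly with
  \<open>i\<close>: the loss \<open>1 / d ^ k\<close> leaves part of the decay of
  \<open>\<psi> i\<close>, while a high power of \<open>d\<close> defeats the growth of the
  derivatives.\<close>

lemma summable_bound_higher_deriv: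
  fixes \<psi> :: "nat \<Rightarrow> real \<Rightarrow> real"
  assumes sm: "\<And>i. smooth_real (\<psi> i)"
    and a: "\<And>i x. \<bar>\<psi> i x\<bar> \<le> a * (1 / 2) ^ i"
    and b: "\<And>k. \<exists>b. \<forall>i x. \<bar>(deriv ^^ k) (\<psi> i) x\<bar> \<le> b * 2 ^ i"
  shows "\<exists>M. summable M \<and> (\<forall>i x. \<bar>(deriv ^^ k) (\<psi> i) x\<bar> \<le> M i)"
proof -
  \<comment> \<open>Half of the decay exponent of \<open>(1 / 2) ^ i\<close> is spent on the
    division by \<open>d ^ k\<close>; what remains is \<open>\<sigma> ^ i\<close>.\<close>
  define \<sigma> where "\<sigma> = sqrt (1 / 2)"
  define \<rho> where "\<rho> = root (Suc k) \<sigma>"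
  have \<sigma>: "0 < \<sigma>" "\<sigma> < 1" "\<sigma> * \<sigma> = 1 / 2"
    by (auto simp: \<sigma>_def)
  have \<rho>: "0 < \<rho>" "\<rho> \<le> 1" "\<rho> ^ Suc k = \<sigma>"
    using \<sigma> by (auto simp: \<rho>_def simp del: power_Suc)
  \<comment> \<open>With this gap \<open>d ^ j\<close> is \<open>\<sigma> ^ i\<close> to the fourth
    power, that is \<open>(1 / 4) ^ i\<close>, which beats \<open>2 ^ i\<close>.\<close>
  define j where "j = 4 * Suc k"
  obtain C where C: "C \<ge> 0" and *: "\<And>u A B d x. smooth_real u \<Longrightarrow> (\<forall>x. \<bar>u x\<bar> \<le> A) \<Longrightarrow> d > 0 \<Longrightarrow>
     (\<forall>x. \<bar>(deriv ^^ (k + j)) u x\<bar> \<le> B) \<Longrightarrow> \<bar>(deriv ^^ k) u x\<bar> \<le> C * (A / d ^ k + d ^ j * B)"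
    using higher_deriv_interpolation[of k j] by blast
  obtain b where b: "\<And>i x. \<bar>(deriv ^^ (k + j)) (\<psi> i) x\<bar> \<le> b * 2 ^ i"
    using b by metis
  have a0: "a \<ge> 0"
    using a[of 0 0] by simp
  have b0: "b \<ge> 0"
    using b[of 0 0] by simp
  have "\<bar>(deriv ^^ k) (\<psi> i) x\<bar> \<le> C * (a + b) * \<sigma> ^ i" for i x
  proof -
    have \<rho>i: "(\<rho> ^ i) ^ Suc k = \<sigma> ^ i"
      by (metis \<rho>(3) mult.commute power_mult)
    have "\<bar>(deriv ^^ k) (\<psi> i) x\<bar> \<le> C * (a * (1 / 2) ^ i / (\<rho> ^ i) ^ k + (\<rho> ^ i) ^ j * (b * 2 ^ i))"
      using \<rho>(1) by (intro * sm) (auto simp: a b)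
    moreover have "a * (1 / 2) ^ i / (\<rho> ^ i) ^ k \<le> a * \<sigma> ^ i"
    proof -
      \<comment> \<open>Since \<open>\<rho> ^ i\<close> is at most 1, raising the exponent to
        \<open>Suc k\<close> only enlarges the quotient and makes the denominator exactly
        \<open>\<sigma> ^ i\<close>.\<close>
      have "a * (1 / 2) ^ i / (\<rho> ^ i) ^ k \<le> a * (1 / 2) ^ i / (\<rho> ^ i) ^ Suc k"
        using \<rho> a0 by (intro divide_left_mono power_decreasing) (auto simp: power_le_one)
      also have "\<dots> = a * \<sigma> ^ i"
        unfolding \<rho>i \<sigma>(3)[symmetric] using \<sigma>(1) by (simp add: power_mult_distrib)
      finally show ?thesis .
    qed
    moreover have "(\<rho> ^ i) ^ j * (b * 2 ^ i) \<le> b * \<sigma> ^ i"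
    proof -
      have "(\<rho> ^ i) ^ j = ((\<rho> ^ i) ^ Suc k) ^ 4"
        unfolding j_def by (metis mult.commute power_mult)
      also have "\<dots> = (\<sigma> * \<sigma>) ^ i * (\<sigma> * \<sigma>) ^ i"
        unfolding \<rho>i by (simp add: power_mult_distrib power4_eq_xxxx)
      finally have "(\<rho> ^ i) ^ j * (b * 2 ^ i) = b * (\<sigma> * \<sigma>) ^ i"
        unfolding \<sigma>(3) by (simp add: power_one_over)
      also have "\<dots> \<le> b * \<sigma> ^ i"
        using \<sigma>(1,2) b0 by (intro mult_left_mono power_mono) (auto intro: mult_left_le)
      finally show ?thesis .
    qed
    ultimately have "\<bar>(deriv ^^ k) (\<psi> i) x\<bar> \<le> C * (a * \<sigma> ^ i + b * \<sigma> ^ i)"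
      using C by (meson add_mono mult_left_mono order_trans)
    then show ?thesis
      by (simp add: algebra_simps)
  qed
  moreover have "summable (\<lambda>i. C * (a + b) * \<sigma> ^ i)"
    using \<sigma> by (intro summable_mult summable_geometric) simp
  ultimately show ?thesis
    by blast
qed

section \<open>Functions of two variables that are smooth along smooth curves\<close>

text \<open>Points where the derivative explodes accumulate in the square. A smooth curve through a
  fast subsequence, running in the \<open>s\<close> direction at each of its points, gives a smooth
  composite whose \<open>k\<close>-th derivative is unbounded near 0.\<close>

lemma bounded_partial_higher_deriv:
  fixes h :: "real \<Rightarrow> real \<Rightarrow> real"
  assumes h: "\<And>a b. smooth_real a \<Longrightarrow> smooth_real b \<Longrightarrow> smooth_real (\<lambda>x. h (a x) (b x))"
  shows "\<exists>B. \<forall>s t. \<bar>s\<bar> \<le> 1 \<longrightarrow> \<bar>t\<bar> \<le> 1 \<longrightarrow> \<bar>(deriv ^^ k) (\<lambda>s. h s t) s\<bar> \<le> B"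
proof (rule ccontr)
  define D where "D = (\<lambda>s t. (deriv ^^ k) (\<lambda>s. h s t) s)"
  assume "\<not> ?thesis"
  then have "\<forall>m::nat. \<exists>s t. \<bar>s\<bar> \<le> 1 \<and> \<bar>t\<bar> \<le> 1 \<and> \<bar>D s t\<bar> > real m"
    unfolding D_def by (metis linorder_not_le)
  then obtain S T where ST: "\<And>m. \<bar>S m\<bar> \<le> 1" "\<And>m. \<bar>T m\<bar> \<le> 1" "\<And>m. \<bar>D (S m) (T m)\<bar> > real m"
    by metis
  have "seq_compact ({-1..1::real} \<times> {-1..1::real})"
    by (intro compact_imp_seq_compact compact_Times compact_Icc)
  moreover have "\<forall>m. (S m, T m) \<in> {-1..1} \<times> {-1..1}"
    using ST by (auto simp: abs_le_iff minus_le_iff)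
  ultimately obtain st r where "strict_mono r" "((\<lambda>m. (S m, T m)) \<circ> r) \<longlonglongrightarrow> st"
    by (rule seq_compactE)
  moreover obtain s t where "st = (s, t)"
    by (cases st)
  ultimately have r: "strict_mono r" "((\<lambda>m. (S m, T m)) \<circ> r) \<longlonglongrightarrow> (s, t)"
    by simp_all
  have lims: "(\<lambda>m. S (r m)) \<longlonglongrightarrow> s" "(\<lambda>m. T (r m)) \<longlonglongrightarrow> t"
    using tendsto_fst[OF r(2)] tendsto_snd[OF r(2)] by (simp_all add: o_def)
  obtain \<tau> l where \<tau>: "\<tau> \<longlonglongrightarrow> 0" and l': "\<forall>j. l j > 0" and
    curve: "\<forall>y z. (\<forall>j. \<bar>y j\<bar> \<le> l j) \<longrightarrow> (\<forall>j. \<bar>z j\<bar> \<le> l j) \<longrightarrow>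
       (\<exists>c. smooth_real c \<and> c 0 = 0 \<and>
         (\<forall>j. eventually (\<lambda>x. c x = y j + z j * (x - \<tau> j)) (nhds (\<tau> j))))"
    by (rule smooth_curve_through_sequences)
  from l' have l: "l j > 0" for j
    by blast
  \<comment> \<open>Slope \<open>l j\<close> scales the \<open>k\<close>-th derivative by
    \<open>l j ^ k\<close>; the last condition compensates this in advance.\<close>
  have "\<exists>m. \<bar>S m - s\<bar> \<le> l j \<and> \<bar>T m - t\<bar> \<le> l j \<and> real j / l j ^ k \<le> real m" for j
  proof -
    have "eventually (\<lambda>m. \<bar>S (r m) - s\<bar> \<le> l j) sequentially"
      "eventually (\<lambda>m. \<bar>T (r m) - t\<bar> \<le> l j) sequentially"
      using tendstoD[OF lims(1) l[of j]] tendstoD[OF lims(2) l[of j]]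
      by (auto simp: dist_real_def intro: less_imp_le elim: eventually_mono)
    moreover have "eventually (\<lambda>m. real j / l j ^ k \<le> real (r m)) sequentially"
      using filterlim_compose[OF filterlim_real_sequentially filterlim_subseq[OF r(1)]]
      by (simp add: filterlim_at_top)
    ultimately have "eventually (\<lambda>m. \<bar>S (r m) - s\<bar> \<le> l j \<and> \<bar>T (r m) - t\<bar> \<le> l j \<and>
        real j / l j ^ k \<le> real (r m)) sequentially"
      by eventually_elim simp
    then show ?thesis
      using eventually_happens' sequentially_bot by blast
  qed
  then obtain q where q: "\<And>j. \<bar>S (q j) - s\<bar> \<le> l j" "\<And>j. \<bar>T (q j) - t\<bar> \<le> l j"
    "\<And>j. real j / l j ^ k \<le> real (q j)"
    by metis
  \<comment> \<open>The first coordinate moves with slope \<open>l j\<close> and the second has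
    slope 0, so near each node only \<open>s\<close> varies.\<close>
  obtain c1 where c1: "smooth_real c1"
    "\<And>j. eventually (\<lambda>x. c1 x = (S (q j) - s) + l j * (x - \<tau> j)) (nhds (\<tau> j))"
    using curve[rule_format, of "\<lambda>j. S (q j) - s" l] q(1) l by (auto simp: abs_of_pos)
  obtain c2 where c2: "smooth_real c2"
    "\<And>j. eventually (\<lambda>x. c2 x = (T (q j) - t) + 0 * (x - \<tau> j)) (nhds (\<tau> j))"
    using curve[rule_format, of "\<lambda>j. T (q j) - t" "\<lambda>_. 0"] q(2) l by (auto simp: less_imp_le)
  define f where "f = (\<lambda>x. h (s + c1 x) (t + c2 x))"
  have f: "smooth_real f"
    unfolding f_def by (intro h smooth_real_intros c1 c2)
  have large: "real j \<le> \<bar>(deriv ^^ k) f (\<tau> j)\<bar>" for j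
  proof -
    define g where "g = (\<lambda>s. h s (T (q j)))"
    have g: "smooth_real g"
      unfolding g_def by (intro h smooth_real_intros)
    have "eventually (\<lambda>x. f x = g ((S (q j) - l j * \<tau> j) + l j * x)) (nhds (\<tau> j))"
      using c1(2)[of j] c2(2)[of j]
    proof eventually_elim
      case (elim x)
      then have "s + c1 x = (S (q j) - l j * \<tau> j) + l j * x" "t + c2 x = T (q j)"
        by (simp_all add: algebra_simps)
      then show ?case
        by (simp add: f_def g_def)
    qed
    then have "(deriv ^^ k) f (\<tau> j) = (deriv ^^ k) (\<lambda>x. g ((S (q j) - l j * \<tau> j) + l j * x)) (\<tau> j)"
      by (rule higher_deriv_cong_at)
    also have "\<dots> = l j ^ k * D (S (q j)) (T (q j))"
      unfolding higher_deriv_affine[OF g] by (simp add: D_def g_def)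
    finally have "\<bar>(deriv ^^ k) f (\<tau> j)\<bar> = l j ^ k * \<bar>D (S (q j)) (T (q j))\<bar>"
      using l[of j] by (simp add: abs_mult)
    moreover have "real j / l j ^ k \<le> \<bar>D (S (q j)) (T (q j))\<bar>"
      using q(3)[of j] ST(3)[of "q j"] by linarith
    ultimately show ?thesis
      using l[of j] by (simp add: field_simps)
  qed
  have "(\<lambda>j. (deriv ^^ k) f (\<tau> j)) \<longlonglongrightarrow> (deriv ^^ k) f 0"
    using smooth_real_continuous[OF smooth_real_higher_deriv[OF f], of UNIV k] \<tau>
    by (auto intro: continuous_on_tendsto_compose)
  then have "eventually (\<lambda>j. \<bar>(deriv ^^ k) f (\<tau> j)\<bar> < \<bar>(deriv ^^ k) f 0\<bar> + 1) sequentially"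
    by (intro order_tendstoD(2)[OF tendsto_rabs]) auto
  moreover have "eventually (\<lambda>j. \<bar>(deriv ^^ k) f 0\<bar> + 1 \<le> real j) sequentially"
    using filterlim_real_sequentially by (simp add: filterlim_at_top)
  ultimately have "eventually (\<lambda>j::nat. False) sequentially"
    by eventually_elim (meson large linorder_not_le order_trans)
  then show False
    by simp
qed

text \<open>The difference quotients in \<open>s\<close> are summed as a telescoping series with
  smooth limit. The assumption \<open>far\<close> turns the bounds on the square into bounds for all
  \<open>t\<close>.\<close>

lemma smooth_real_partial_deriv:
  fixes h :: "real \<Rightarrow> real \<Rightarrow> real"
  assumes h: "\<And>a b. smooth_real a \<Longrightarrow> smooth_real b \<Longrightarrow> smooth_real (\<lambda>x. h (a x) (b x))"
    and far: "\<And>s t. \<bar>t\<bar> \<ge> 1 \<Longrightarrow> h s t = h s 0"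
  shows "smooth_real (\<lambda>t. deriv (\<lambda>s. h s t) 0)"
proof -
  define T where "T = (\<lambda>j. (1 / 2 :: real) ^ j)"
  have T: "0 < T j" "T j \<le> 1" "T (Suc j) = T j / 2" for j
    by (auto simp: T_def power_le_one)
  define \<phi> where "\<phi> = (\<lambda>j t. (h (T j) t - h 0 t) / T j)"
  define \<psi> where "\<psi> = (\<lambda>j t. \<phi> (Suc j) t - \<phi> j t)"
  define D where "D = (\<lambda>t. deriv (\<lambda>s. h s t) 0)"
  have hs: "smooth_real (\<lambda>s. h s t)" and ht: "smooth_real (\<lambda>t. h s t)" for s t
    by (intro h smooth_real_intros)+
  have s\<phi>: "smooth_real (\<phi> j)" for j
    unfolding \<phi>_def by (intro smooth_real_intros ht)
  have s\<psi>: "smooth_real (\<psi> j)" for j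
    unfolding \<psi>_def by (intro smooth_real_intros s\<phi>)
  obtain B where B: "\<And>s t. \<bar>s\<bar> \<le> 1 \<Longrightarrow> \<bar>t\<bar> \<le> 1 \<Longrightarrow> \<bar>(deriv ^^ 2) (\<lambda>s. h s t) s\<bar> \<le> B"
    using bounded_partial_higher_deriv[of h 2] h by blast
  \<comment> \<open>The mean value theorem turns the quotient into the \<open>s\<close>-derivative
    at a point between 0 and \<open>T j\<close>, and \<open>B\<close> bounds the second
    \<open>s\<close>-derivative.\<close>
  have near_le: "\<bar>\<phi> j t - D t\<bar> \<le> B * T j" if le: "\<bar>t\<bar> \<le> 1" for j t
  proof -
    let ?f = "\<lambda>s. h s t"
    obtain z where z: "0 < z" "z < T j" "h (T j) t - h 0 t = (T j - 0) * deriv ?f z"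
      using MVT2[of 0 "T j" ?f "deriv ?f"] T smooth_real_DERIV[OF hs] by blast
    have "\<bar>deriv ?f z - deriv ?f 0\<bar> \<le> B * \<bar>z - 0\<bar>"
    proof (rule DERIV_bound_lipschitz[of "{0..1}"])
      show "(deriv ?f has_field_derivative (deriv ^^ 2) ?f x) (at x)" for x
        using smooth_real_higher_DERIV[OF hs, of 1] by (simp add: numeral_2_eq_2)
      show "\<bar>(deriv ^^ 2) ?f x\<bar> \<le> B" if "x \<in> {0..1}" for x
        using that le by (intro B) auto
    qed (use z T(2)[of j] in auto)
    moreover have "B \<ge> 0"
      using B[of 0 t] le by (simp add: order_trans[OF abs_ge_zero])
    then have "B * z \<le> B * T j"
      using z by (intro mult_left_mono) auto
    ultimately show ?thesis
      using z T(1)[of j] by (simp add: \<phi>_def D_def)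
  qed
  have near: "\<bar>\<phi> j t - D t\<bar> \<le> B * T j" for j t
  proof (cases "\<bar>t\<bar> \<le> 1")
    case False
    then have "\<phi> j t = \<phi> j 0" "D t = D 0"
      using far[of t] unfolding \<phi>_def D_def by simp_all
    then show ?thesis
      using near_le[of 0 j] by simp
  qed (rule near_le)
  have B0: "B \<ge> 0"
    using near[of 0 0] by (simp add: T_def)
  have \<psi>_bound: "\<bar>\<psi> j t\<bar> \<le> (2 * B) * (1 / 2) ^ j" for j t
  proof -
    have "B * T (Suc j) \<le> B * T j"
      using B0 T[of j] by (intro mult_left_mono) auto
    then have "\<bar>\<psi> j t\<bar> \<le> 2 * (B * T j)"
      using near[of j t] near[of "Suc j" t] unfolding \<psi>_def by linarith
    then show ?thesis
      by (simp add: T_def)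
  qed
  have \<psi>_deriv_bound: "\<exists>b. \<forall>j t. \<bar>(deriv ^^ k) (\<psi> j) t\<bar> \<le> b * 2 ^ j" for k
  proof -
    obtain b where "\<And>s t. \<bar>s\<bar> \<le> 1 \<Longrightarrow> \<bar>t\<bar> \<le> 1 \<Longrightarrow> \<bar>(deriv ^^ k) (\<lambda>t. h s t) t\<bar> \<le> b"
      \<comment> \<open>With the two variables exchanged, the same result bounds the
        \<open>t\<close>-derivatives.\<close>
      using bounded_partial_higher_deriv[of "\<lambda>t s. h s t" k] h by blast
    note b_le = this
    have b: "\<bar>(deriv ^^ k) (h s) t\<bar> \<le> b" if s: "\<bar>s\<bar> \<le> 1" for s t
    proof (cases "\<bar>t\<bar> \<le> 1")
      case False
      then have "eventually (\<lambda>t. t \<in> - {-1..1}) (nhds t)"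
        by (intro eventually_nhds_in_open) auto
      then have "eventually (\<lambda>t. h s t = h s 0) (nhds t)"
        by eventually_elim (use far in force)
      then have *: "(deriv ^^ k) (h s) t = (deriv ^^ k) (\<lambda>_. h s 0) t"
        by (rule higher_deriv_cong_at)
      show ?thesis
      proof (cases k)
        case 0
        then show ?thesis
          using b_le[OF s, of 0] * by simp
      next
        case (Suc k')
        then have "(deriv ^^ k) (h s) t = 0"
          using * by (simp only: higher_deriv_const)
        then show ?thesis
          using b_le[OF s, of 0] by simp
      qed
    qed (use b_le[OF s] in simp)
    \<comment> \<open>Over the common denominator \<open>T j\<close> the quotients contribute
      coefficients 2, -1 and -1, whose absolute values add up to 4.\<close>
    have "\<bar>(deriv ^^ k) (\<psi> j) t\<bar> \<le> 4 * b * 2 ^ j" for j t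
    proof -
      define g where "g = (\<lambda>t. (-1) * h (T j) t + (-1) * h 0 t)"
      have g: "smooth_real g"
        unfolding g_def by (intro smooth_real_intros ht)
      have "\<psi> j = (\<lambda>t. (2 / T j) * h (T (Suc j)) t + (1 / T j) * g t)"
        using T(1)[of j] by (auto simp: \<psi>_def \<phi>_def g_def T(3) field_simps)
      then have "(deriv ^^ k) (\<psi> j) t = (2 / T j) * (deriv ^^ k) (h (T (Suc j))) t
          + (1 / T j) * ((-1) * (deriv ^^ k) (h (T j)) t + (-1) * (deriv ^^ k) (h 0) t)"
        by (simp only: higher_deriv_lincomb[OF ht g])
          (simp only: g_def higher_deriv_lincomb[OF ht ht])
      also have "\<dots> = (2 * (deriv ^^ k) (h (T (Suc j))) t - (deriv ^^ k) (h (T j)) t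
          - (deriv ^^ k) (h 0) t) / T j"
        by (simp add: diff_divide_distrib)
      also have "\<bar>\<dots>\<bar> \<le> 4 * b / T j"
      proof -
        have "\<bar>2 * (deriv ^^ k) (h (T (Suc j))) t - (deriv ^^ k) (h (T j)) t - (deriv ^^ k) (h 0) t\<bar>
            \<le> 4 * b"
        proof -
          have "\<bar>T (Suc j)\<bar> \<le> 1" "\<bar>T j\<bar> \<le> 1" "\<bar>0::real\<bar> \<le> 1"
            using T(1)[of j] T(2)[of j] T(1)[of "Suc j"] T(2)[of "Suc j"] by simp_all
          from this[THEN b[of _ t]] show ?thesis
            by linarith
        qed
        then show ?thesis
          using T(1)[of j] by (simp add: divide_right_mono)
      qed
      finally show ?thesis
        by (simp add: T_def power_one_over)
    qed
    then show ?thesis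
      by blast
  qed
  have "D = (\<lambda>t. \<phi> 0 t + (\<Sum>j. \<psi> j t))"
  proof
    fix t
    have "T \<longlonglongrightarrow> 0"
      unfolding T_def by (intro LIMSEQ_power_zero) simp
    then have "(\<lambda>n. B * T n) \<longlonglongrightarrow> 0"
      by (rule tendsto_mult_right_zero)
    moreover have "eventually (\<lambda>n. norm (\<phi> n t - D t) \<le> B * T n) sequentially"
      by (simp add: near)
    ultimately have "(\<lambda>n. \<phi> n t - D t) \<longlonglongrightarrow> 0"
      by (rule Lim_null_comparison[rotated])
    then have "(\<lambda>n. \<phi> n t) \<longlonglongrightarrow> D t"
      using LIM_zero_iff by blast
    then have "(\<lambda>j. \<psi> j t) sums (D t - \<phi> 0 t)"
      unfolding \<psi>_def by (rule telescope_sums)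
    then show "D t = \<phi> 0 t + (\<Sum>j. \<psi> j t)"
      by (simp add: sums_iff)
  qed
  moreover have "smooth_real (\<lambda>t. \<phi> 0 t + (\<Sum>j. \<psi> j t))"
    by (rule smooth_real_add[OF s\<phi> smooth_real_suminf[OF s\<psi>
        summable_bound_higher_deriv[OF s\<psi> \<psi>_bound \<psi>_deriv_bound]]])
  ultimately show ?thesis
    unfolding D_def by simp
qed

section \<open>Boman's theorem\<close>

lemma tendsto_funI:
  fixes f :: "'a \<Rightarrow> 'b \<Rightarrow> 'c::topological_space"
  assumes "\<And>i. ((\<lambda>x. f x i) \<longlongrightarrow> l i) F"
  shows "(f \<longlongrightarrow> l) F"
  using limitin_componentwise[of "\<lambda>_. euclidean" UNIV f l F] assms
  by (simp add: euclidean_product_topology)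

lemma openin_Euclidean_space_zero:
  "openin (Euclidean_space n) U \<Longrightarrow> x \<in> U \<Longrightarrow> i \<ge> n \<Longrightarrow> x i = 0"
  using openin_subset topspace_Euclidean_space by blast

text \<open>Otherwise points outside \<open>U\<close> taken from boxes of radius
  \<open>1 / (m + 1)\<close> would converge coordinatewise, hence in the product topology, to
  \<open>x\<close>.\<close>

lemma openin_Euclidean_space_contains_box:
  assumes U: "openin (Euclidean_space n) U" and x: "x \<in> U"
  obtains e where "e > 0"
    "\<forall>y. (\<forall>i\<ge>n. y i = 0) \<longrightarrow> (\<forall>i<n. \<bar>y i - x i\<bar> \<le> e) \<longrightarrow> y \<in> U"
proof -
  obtain W where W: "open W" "U = W \<inter> {x. \<forall>i\<ge>n. x i = 0}"
    using U unfolding Euclidean_space_def openin_subtopology euclidean_product_topology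
      open_openin[symmetric] by blast
  have "\<exists>e>0. \<forall>y. (\<forall>i\<ge>n. y i = 0) \<longrightarrow> (\<forall>i<n. \<bar>y i - x i\<bar> \<le> e) \<longrightarrow> y \<in> U"
  proof (rule ccontr)
    assume no: "\<not> ?thesis"
    have "\<exists>y. (\<forall>i\<ge>n. y i = 0) \<and> (\<forall>i<n. \<bar>y i - x i\<bar> \<le> inverse (real (Suc m))) \<and> y \<notin> U" for m
    proof -
      have "inverse (real (Suc m)) > 0"
        by simp
      with no show ?thesis
        by blast
    qed
    then have "\<exists>y. \<forall>m. (\<forall>i\<ge>n. y m i = 0) \<and> (\<forall>i<n. \<bar>y m i - x i\<bar> \<le> inverse (real (Suc m))) \<and> y m \<notin> U"
      by (intro choice allI)
    then obtain y where y: "\<And>m i. i \<ge> n \<Longrightarrow> y m i = 0" "\<And>m. y m \<notin> U"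
      "\<And>m i. i < n \<Longrightarrow> \<bar>y m i - x i\<bar> \<le> inverse (real (Suc m))"
      by blast
    have "y \<longlonglongrightarrow> x"
    proof (rule tendsto_funI)
      fix i
      show "(\<lambda>m. y m i) \<longlonglongrightarrow> x i"
      proof (cases "i < n")
        case True
        have "(\<lambda>m. y m i - x i) \<longlonglongrightarrow> 0"
          by (rule Lim_null_comparison[OF _ LIMSEQ_inverse_real_of_nat]) (use y(3)[OF True] in \<open>simp del: of_nat_Suc\<close>)
        then show ?thesis
          using LIM_zero_iff by blast
      next
        case False
        then show ?thesis
          using y(1) openin_Euclidean_space_zero[OF U x] by simp
      qed
    qed
    moreover have "x \<in> W"
      using x W by blast
    ultimately have "eventually (\<lambda>m. y m \<in> W) sequentially"
      using W(1) topological_tendstoD by blast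
    then obtain m where "y m \<in> W"
      using eventually_happens' sequentially_bot by blast
    then show False
      using y(1,2) W(2) by auto
  qed
  then show thesis
    using that by blast
qed

lemma openin_Euclidean_space_Int_box:
  assumes "openin (Euclidean_space n) U"
  shows "openin (Euclidean_space n) (U \<inter> {y. \<forall>i<n. \<bar>y i - x i\<bar> < e})"
proof -
  have "open {y :: nat \<Rightarrow> real. \<forall>i\<in>{..<n}. y i \<in> {x i - e<..<x i + e}}"
    by (rule product_topology_basis'[of "{..<n}" "\<lambda>i. {x i - e<..<x i + e}" "\<lambda>i. i"]) auto
  moreover have "{y :: nat \<Rightarrow> real. \<forall>i\<in>{..<n}. y i \<in> {x i - e<..<x i + e}} = {y. \<forall>i<n. \<bar>y i - x i\<bar> < e}"
  proof -
    have "y i \<in> {x i - e<..<x i + e} \<longleftrightarrow> \<bar>y i - x i\<bar> < e" for y :: "nat \<Rightarrow> real" and i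
      unfolding greaterThanLessThan_iff by linarith
    then show ?thesis
      by (simp only: Ball_def lessThan_iff)
  qed
  ultimately have o: "open {y. \<forall>i<n. \<bar>y i - x i\<bar> < e}"
    by simp
  obtain W where W: "open W" "U = W \<inter> {x. \<forall>i\<ge>n. x i = 0}"
    using assms unfolding Euclidean_space_def openin_subtopology euclidean_product_topology
      open_openin[symmetric] by blast
  have "U \<inter> {y. \<forall>i<n. \<bar>y i - x i\<bar> < e} = (W \<inter> {y. \<forall>i<n. \<bar>y i - x i\<bar> < e}) \<inter> {x. \<forall>i\<ge>n. x i = 0}"
    using W(2) by blast
  then show ?thesis
    using open_Int[OF W(1) o] unfolding Euclidean_space_def openin_subtopology
      euclidean_product_topology open_openin[symmetric] by blast
qed

section \<open>Smooth curves in open sets and functions smooth along them\<close>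

definition smooth_curve :: "(nat \<Rightarrow> real) set \<Rightarrow> (real \<Rightarrow> nat \<Rightarrow> real) \<Rightarrow> bool" where
  "smooth_curve U c \<longleftrightarrow> (\<forall>t. c t \<in> U) \<and> (\<forall>i. smooth_real (\<lambda>t. c t i))"

text \<open>The test curves live on the whole line and stay in \<open>U\<close>; a curve that is in
  \<open>U\<close> only for a short time is first reparametrized by \<open>cutoff\<close>.\<close>

definition curve_smooth :: "(nat \<Rightarrow> real) set \<Rightarrow> ((nat \<Rightarrow> real) \<Rightarrow> real) \<Rightarrow> bool" where
  "curve_smooth U g \<longleftrightarrow> (\<forall>c. smooth_curve U c \<longrightarrow> smooth_real (\<lambda>t. g (c t)))"

lemma smooth_real_bounded_near:
  assumes "\<And>i. smooth_real (c i)" "e > 0"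
  obtains d where "d > 0" "d \<le> 1" "\<forall>t. \<bar>t - t0\<bar> \<le> d \<longrightarrow> (\<forall>i<n::nat. \<bar>c i t - c i t0\<bar> \<le> e)"
proof -
  have "eventually (\<lambda>t. \<forall>i\<in>{..<n}. \<bar>c i t - c i t0\<bar> < e) (nhds t0)"
  proof (intro eventually_ball_finite ballI)
    fix i
    have "(c i \<longlongrightarrow> c i t0) (nhds t0)"
      using DERIV_isCont[OF smooth_real_DERIV[OF assms(1), of i t0]]
      by (simp only: isCont_def tendsto_at_iff_tendsto_nhds)
    from tendstoD[OF this \<open>e > 0\<close>] show "eventually (\<lambda>t. \<bar>c i t - c i t0\<bar> < e) (nhds t0)"
      by (simp add: dist_real_def)
  qed auto
  then obtain d where d: "d > 0" "\<And>t. dist t t0 < d \<Longrightarrow> \<forall>i\<in>{..<n}. \<bar>c i t - c i t0\<bar> < e"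
    unfolding eventually_nhds_metric by blast
  show thesis
  proof (rule that[of "min 1 (d / 2)"])
    show "\<forall>t. \<bar>t - t0\<bar> \<le> min 1 (d / 2) \<longrightarrow> (\<forall>i<n. \<bar>c i t - c i t0\<bar> \<le> e)"
    proof (intro allI impI)
      fix t i
      assume "\<bar>t - t0\<bar> \<le> min 1 (d / 2)" "i < n"
      then show "\<bar>c i t - c i t0\<bar> \<le> e"
        using d(1) d(2)[of t] by (auto simp: dist_real_def intro: less_imp_le)
    qed
  qed (use d in auto)
qed

lemma localize_curve:
  assumes U: "openin (Euclidean_space n) U" and c: "\<And>i. smooth_real (\<lambda>t. c t i)"
    and z: "\<And>t i. i \<ge> n \<Longrightarrow> c t i = 0" and t0: "c t0 \<in> U"
  obtains d where "d > 0" "smooth_curve U (\<lambda>t. c (t0 + cutoff d (t - t0)))"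
proof -
  obtain e where e: "e > 0" "\<forall>y. (\<forall>i\<ge>n. y i = 0) \<longrightarrow> (\<forall>i<n. \<bar>y i - c t0 i\<bar> \<le> e) \<longrightarrow> y \<in> U"
    by (rule openin_Euclidean_space_contains_box[OF U t0])
  obtain d where d: "d > 0" "d \<le> 1" "\<forall>t. \<bar>t - t0\<bar> \<le> d \<longrightarrow> (\<forall>i<n. \<bar>c t i - c t0 i\<bar> \<le> e)"
    by (rule smooth_real_bounded_near[of "\<lambda>i t. c t i", OF c e(1), of t0 n])
  have "c (t0 + cutoff d (t - t0)) \<in> U" for t
    using e(2) z d(3) cutoff_bound[OF d(1)] by simp
  moreover have "smooth_real (\<lambda>t. c (t0 + cutoff d (t - t0)) i)" for i
    by (intro smooth_real_compose[OF c] smooth_real_compose[OF smooth_real_cutoff] smooth_real_intros)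
  ultimately show thesis
    using that[OF d(1)] by (simp add: smooth_curve_def)
qed

lemma eventually_cutoff:
  assumes "d > 0"
  shows "eventually (\<lambda>t. t0 + cutoff d (t - t0) = t) (nhds t0)"
proof -
  have "eventually (\<lambda>t. t \<in> {t0 - d / 2<..<t0 + d / 2}) (nhds t0)"
    using assms by (intro eventually_nhds_in_open) auto
  then show ?thesis
  proof eventually_elim
    case (elim t)
    then have "\<bar>t - t0\<bar> \<le> d / 2"
      unfolding greaterThanLessThan_iff by linarith
    then show ?case
      by (simp add: cutoff_eq)
  qed
qed

text \<open>If \<open>g\<close> kept a distance \<open>e\<close> from \<open>g a\<close> along a
  sequence tending to \<open>a\<close>, a smooth curve through a fast subsequence would give a
  discontinuous composite.\<close>

lemma curve_smooth_continuous_on: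
  assumes U: "openin (Euclidean_space n) U" and g: "curve_smooth U g"
  shows "continuous_on U g"
proof (rule continuous_on_sequentiallyI)
  fix u a
  assume u: "\<forall>m::nat. u m \<in> U" and a: "a \<in> U" and ua: "u \<longlonglongrightarrow> a"
  show "(\<lambda>m. g (u m)) \<longlonglongrightarrow> g a"
  proof (rule ccontr)
    assume "\<not> ?thesis"
    then obtain e where e: "e > 0" and "\<not> eventually (\<lambda>m. dist (g (u m)) (g a) < e) sequentially"
      unfolding tendsto_iff by blast
    then have ne: "frequently (\<lambda>m. \<not> dist (g (u m)) (g a) < e) sequentially"
      by (simp add: not_eventually)
    obtain \<tau> l where \<tau>: "\<tau> \<longlonglongrightarrow> 0" and l: "\<forall>j. l j > 0" and
      curve: "\<forall>y z. (\<forall>j. \<bar>y j\<bar> \<le> l j) \<longrightarrow> (\<forall>j. \<bar>z j\<bar> \<le> l j) \<longrightarrow>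
         (\<exists>c. smooth_real c \<and> c 0 = 0 \<and>
           (\<forall>j. eventually (\<lambda>x. c x = y j + z j * (x - \<tau> j)) (nhds (\<tau> j))))"
      by (rule smooth_curve_through_sequences)
    have "\<exists>m. dist (g (u m)) (g a) \<ge> e \<and> (\<forall>i<n. \<bar>u m i - a i\<bar> \<le> l j)" for j
    proof -
      have "(\<lambda>m. u m i) \<longlonglongrightarrow> a i" for i
        by (rule continuous_on_tendsto_compose[OF continuous_on_product_coordinates ua]) auto
      from tendstoD[OF this, of "l j"] have "eventually (\<lambda>m. \<forall>i\<in>{..<n}. \<bar>u m i - a i\<bar> < l j) sequentially"
        using l by (intro eventually_ball_finite) (auto simp: dist_real_def)
      then have "frequently (\<lambda>m. \<not> dist (g (u m)) (g a) < e \<and> (\<forall>i\<in>{..<n}. \<bar>u m i - a i\<bar> < l j)) sequentially"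
        by (intro frequently_rev_mp[OF ne]) (elim eventually_mono, blast)
      then obtain m where "\<not> dist (g (u m)) (g a) < e" "\<forall>i\<in>{..<n}. \<bar>u m i - a i\<bar> < l j"
        using frequently_ex by blast
      then show ?thesis
        by (intro exI[of _ m]) (auto simp: less_imp_le)
    qed
    then obtain q where q: "\<And>j. dist (g (u (q j))) (g a) \<ge> e" "\<And>j i. i < n \<Longrightarrow> \<bar>u (q j) i - a i\<bar> \<le> l j"
      by metis
    have zero: "u m i = 0" "a i = 0" if "i \<ge> n" for i m
      using openin_Euclidean_space_zero[OF U _ that] u a by blast+
    \<comment> \<open>The coordinates from \<open>n\<close> on must vanish identically for the curve
      to stay in the Euclidean space.\<close>
    have "\<exists>c. smooth_real c \<and> c 0 = 0 \<and> (\<forall>j. c (\<tau> j) = u (q j) i - a i) \<and> (i \<ge> n \<longrightarrow> c = (\<lambda>_. 0))" for i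
    proof (cases "i < n")
      case True
      then obtain c where c: "smooth_real c" "c 0 = 0"
        "\<forall>j. eventually (\<lambda>x. c x = (u (q j) i - a i) + 0 * (x - \<tau> j)) (nhds (\<tau> j))"
        using curve[rule_format, of "\<lambda>j. u (q j) i - a i" "\<lambda>_. 0"] q(2) l by (auto simp: less_imp_le)
      then have "c (\<tau> j) = u (q j) i - a i" for j
        using eventually_nhds_x_imp_x[OF c(3)[rule_format, of j]] by simp
      then show ?thesis
        using c True by (intro exI[of _ c]) auto
    next
      case False
      then show ?thesis
        using zero smooth_real_const by (intro exI[of _ "\<lambda>_. 0"]) auto
    qed
    then obtain C where C: "\<And>i. smooth_real (C i)" "\<And>i. C i 0 = 0"
      "\<And>i j. C i (\<tau> j) = u (q j) i - a i" "\<And>i. i \<ge> n \<Longrightarrow> C i = (\<lambda>_. 0)"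
      by metis
    define c where "c = (\<lambda>t i. a i + C i t)"
    have "smooth_real (\<lambda>t. c t i)" for i
      unfolding c_def by (intro smooth_real_intros C)
    moreover have "c t i = 0" if "i \<ge> n" for t i
      using that C(4) zero by (simp add: c_def)
    moreover have c0: "c 0 = a"
      by (simp add: c_def C)
    moreover have c\<tau>: "c (\<tau> j) = u (q j)" for j
      by (simp add: c_def C)
    ultimately obtain d where d: "d > 0" "smooth_curve U (\<lambda>t. c (0 + cutoff d (t - 0)))"
      using localize_curve[OF U, of c 0] a by metis
    define f where "f = (\<lambda>t. g (c (0 + cutoff d (t - 0))))"
    have "smooth_real f"
      using g d(2) unfolding f_def curve_smooth_def by blast
    then have "(\<lambda>j. f (\<tau> j)) \<longlonglongrightarrow> f 0"
      using smooth_real_continuous[of f UNIV] \<tau> by (auto intro: continuous_on_tendsto_compose)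
    then have "eventually (\<lambda>j. dist (f (\<tau> j)) (f 0) < e) sequentially"
      using e tendstoD by blast
    moreover have "eventually (\<lambda>j. 0 + cutoff d (\<tau> j - 0) = \<tau> j) sequentially"
      using eventually_compose_filterlim[OF eventually_cutoff[OF d(1)] \<tau>] .
    ultimately have "eventually (\<lambda>j::nat. False) sequentially"
    proof eventually_elim
      case (elim j)
      moreover have "f 0 = g a"
        using eventually_nhds_x_imp_x[OF eventually_cutoff[OF d(1), of 0]] c0 by (simp add: f_def)
      ultimately show ?case
        using q(1)[of j] c\<tau>[of j] by (simp add: f_def)
    qed
    then show False
      by simp
  qed
qed

lemma DERIV_shift_0:
  fixes f :: "real \<Rightarrow> real"
  shows "((\<lambda>s. f (a + s)) has_field_derivative D) (at 0) \<longleftrightarrow> (f has_field_derivative D) (at a)"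
  using DERIV_shift[of f D 0 a] by (simp add: add.commute)

lemma deriv_shift_0:
  fixes f :: "real \<Rightarrow> real"
  shows "deriv (\<lambda>s. f (a + s)) 0 = deriv f a"
  unfolding deriv_def DERIV_shift_0 ..

lemma curve_smooth_partial_differentiable:
  assumes U: "openin (Euclidean_space n) U" and g: "curve_smooth U g" and "i < n" "x \<in> U"
  shows "(\<lambda>t. g (x(i := t))) differentiable (at (x i))"
proof -
  \<comment> \<open>The coordinate line through \<open>x\<close> with parameter 0 at
    \<open>x\<close>; it is then confined to \<open>U\<close>.\<close>
  define c where "c = (\<lambda>t. x(i := x i + t))"
  have "smooth_real (\<lambda>t. c t j)" for j
    unfolding c_def by (cases "j = i") (auto intro!: smooth_real_intros)
  moreover have "c t j = 0" if "j \<ge> n" for t j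
    using that openin_Euclidean_space_zero[OF U \<open>x \<in> U\<close> that] \<open>i < n\<close> by (simp add: c_def)
  moreover have "c 0 \<in> U"
    using \<open>x \<in> U\<close> by (simp add: c_def)
  ultimately obtain d where d: "d > 0" "smooth_curve U (\<lambda>t. c (0 + cutoff d (t - 0)))"
    using localize_curve[OF U, of c 0] by metis
  then have "smooth_real (\<lambda>t. g (c (0 + cutoff d (t - 0))))"
    using g unfolding curve_smooth_def by blast
  note smooth_real_DERIV[OF this, of 0]
  moreover have "eventually (\<lambda>t. g (x(i := x i + t)) = g (c (0 + cutoff d (t - 0)))) (nhds 0)"
    using eventually_cutoff[OF d(1), of 0] by eventually_elim (simp add: c_def)
  ultimately have "\<exists>D. ((\<lambda>t. g (x(i := x i + t))) has_field_derivative D) (at 0)"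
    by (intro exI) (rule DERIV_transform_ev[rotated])
  then show ?thesis
    using DERIV_shift_0[of "\<lambda>t. g (x(i := t))" "x i"] real_differentiable_def by blast
qed

text \<open>Along a curve through time \<open>t0\<close> the partial derivative is the
  \<open>s\<close>-derivative at 0 of \<open>g\<close> at the curve point displaced by
  \<open>s\<close> in coordinate \<open>i\<close>. Cutting off both variables defines this function
  on the whole plane, so the two-variable result applies.\<close>

lemma curve_smooth_partial_deriv:
  assumes U: "openin (Euclidean_space n) U" and g: "curve_smooth U g" and i: "i < n"
  shows "curve_smooth U (partial_deriv i g)"
  unfolding curve_smooth_def
proof (intro allI impI smooth_real_locally)
  fix c t0
  assume c: "smooth_curve U c"
  have cs: "smooth_real (\<lambda>t. c t j)" for j
    using c by (simp add: smooth_curve_def)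
  have cU: "c t \<in> U" for t
    using c by (simp add: smooth_curve_def)
  have c0: "c t j = 0" if "j \<ge> n" for t j
    using openin_Euclidean_space_zero[OF U cU that] .
  obtain e where e: "e > 0" "\<forall>y. (\<forall>i\<ge>n. y i = 0) \<longrightarrow> (\<forall>i<n. \<bar>y i - c t0 i\<bar> \<le> e) \<longrightarrow> y \<in> U"
    by (rule openin_Euclidean_space_contains_box[OF U cU])
  \<comment> \<open>Half of the box is reserved for the motion along the curve, the other half for
    the displacement in coordinate \<open>i\<close>.\<close>
  have e2: "e / 2 > 0"
    using e by simp
  obtain d where d: "d > 0" "d \<le> 1" "\<forall>t. \<bar>t - t0\<bar> \<le> d \<longrightarrow> (\<forall>j<n. \<bar>c t j - c t0 j\<bar> \<le> e / 2)"
    by (rule smooth_real_bounded_near[of "\<lambda>i t. c t i", OF cs e2, of t0 n])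
  define p where "p = (\<lambda>s t. (c (t0 + cutoff d t))(i := c (t0 + cutoff d t) i + cutoff (e / 2) s))"
  define h where "h = (\<lambda>s t. g (p s t))"
  have pU: "p s t \<in> U" for s t
  proof -
    have "\<bar>c (t0 + cutoff d t) j - c t0 j\<bar> \<le> e / 2" if "j < n" for j
      using d(3) cutoff_bound[OF d(1)] that by simp
    moreover have "\<bar>cutoff (e / 2) s\<bar> \<le> e / 2"
      using cutoff_bound[OF e2] .
    moreover have "p s t j = c (t0 + cutoff d t) j + (if j = i then cutoff (e / 2) s else 0)" for j
      by (simp add: p_def)
    ultimately have "\<bar>p s t j - c t0 j\<bar> \<le> e" if "j < n" for j
      using that e(1) by (smt (verit) field_sum_of_halves)
    moreover have "p s t j = 0" if "j \<ge> n" for j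
      using c0[OF that] that i by (simp add: p_def)
    ultimately show ?thesis
      using e(2) by blast
  qed
  have "smooth_real (\<lambda>t. deriv (\<lambda>s. h s t) 0)"
  proof (rule smooth_real_partial_deriv)
    fix a b :: "real \<Rightarrow> real"
    assume ab: "smooth_real a" "smooth_real b"
    have 1: "smooth_real (\<lambda>x. c (t0 + cutoff d (b x)) j)" for j
      by (intro smooth_real_compose[OF cs] smooth_real_intros smooth_real_compose[OF smooth_real_cutoff] ab)
    have 2: "smooth_real (\<lambda>x. cutoff (e / 2) (a x))"
      by (intro smooth_real_compose[OF smooth_real_cutoff] ab)
    have "smooth_real (\<lambda>x. p (a x) (b x) j)" for j
      using 1[of j] smooth_real_add[OF 1[of j] 2] by (cases "j = i") (simp_all add: p_def)
    then have "smooth_curve U (\<lambda>x. p (a x) (b x))"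
      using pU by (simp add: smooth_curve_def)
    then show "smooth_real (\<lambda>x. h (a x) (b x))"
      using g by (simp add: h_def curve_smooth_def)
  next
    fix s t :: real
    assume "\<bar>t\<bar> \<ge> 1"
    \<comment> \<open>Because \<open>d \<le> 1\<close>, the cut-off is already inactive where
      \<open>far\<close> requires independence of \<open>t\<close>.\<close>
    then have "cutoff d t = 0"
      using d by (simp add: cutoff_eq_0)
    then show "h s t = h s 0"
      using d by (simp add: h_def p_def cutoff_eq)
  qed
  from smooth_real_compose[OF this, of "\<lambda>t. t - t0"]
  have "smooth_real (\<lambda>t. deriv (\<lambda>s. h s (t - t0)) 0)"
    by (simp add: smooth_real_intros)
  moreover have "eventually (\<lambda>t. partial_deriv i g (c t) = deriv (\<lambda>s. h s (t - t0)) 0) (nhds t0)"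
    using eventually_cutoff[OF d(1)]
  proof eventually_elim
    case (elim t)
    have "eventually (\<lambda>s. h s (t - t0) = g ((c t)(i := c t i + s))) (nhds 0)"
      using eventually_cutoff[OF e2, of 0]
      by eventually_elim (use elim in \<open>simp add: h_def p_def\<close>)
    then have "deriv (\<lambda>s. h s (t - t0)) 0 = deriv (\<lambda>s. g ((c t)(i := c t i + s))) 0"
      by (rule deriv_cong_ev) simp
    also have "\<dots> = partial_deriv i g (c t)"
      unfolding partial_deriv_def by (rule deriv_shift_0)
    finally show ?case
      by simp
  qed
  ultimately show "\<exists>f. smooth_real f \<and> eventually (\<lambda>t. partial_deriv i g (c t) = f t) (nhds t0)"
    by (intro exI[of _ "\<lambda>t. deriv (\<lambda>s. h s (t - t0)) 0"]) simp
qed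

text \<open>\<open>curve_smooth\<close> gives continuity and existence of partial derivatives, and
  passes to them, so induction on \<open>k\<close> yields every \<open>Ck_on\<close>.\<close>

lemma curve_smooth_imp_smooth_on:
  assumes "openin (Euclidean_space n) U" "curve_smooth U g"
  shows "smooth_on n U g"
proof -
  have "curve_smooth U g \<Longrightarrow> Ck_on k n U g" for k g
    by (induction k arbitrary: g)
      (simp_all add: curve_smooth_continuous_on[OF assms(1)] curve_smooth_partial_deriv[OF assms(1)]
        curve_smooth_partial_differentiable[OF assms(1)])
  then show ?thesis
    using assms(2) by (simp add: smooth_on_def)
qed

section \<open>The chain rule along smooth curves\<close>

lemma MVT_unordered:
  fixes F :: "real \<Rightarrow> real"
  assumes "\<And>s. \<bar>s - u\<bar> \<le> \<bar>v - u\<bar> \<Longrightarrow> (F has_field_derivative F' s) (at s)"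
  shows "\<exists>s. \<bar>s - u\<bar> \<le> \<bar>v - u\<bar> \<and> F v - F u = (v - u) * F' s"
proof -
  consider "u < v" | "v < u" | "u = v" by linarith
  then show ?thesis
  proof cases
    case 1
    then obtain s where "u < s" "s < v" "F v - F u = (v - u) * F' s"
      using MVT2[of u v F F'] assms by force
    then show ?thesis
      by (intro exI[of _ s]) auto
  next
    case 2
    then obtain s where s: "v < s" "s < u" "F u - F v = (u - v) * F' s"
      using MVT2[of v u F F'] assms by force
    then have "F v - F u = (v - u) * F' s"
      by (simp add: algebra_simps)
    then show ?thesis
      using s by (intro exI[of _ s]) auto
  next
    case 3
    then show ?thesis
      by (intro exI[of _ u]) auto
  qed
qed

text \<open>The increment of \<open>g\<close> is split by changing one coordinate at a time. The
  mean value theorem handles each change, and continuity of the partial derivatives gives the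
  limit.\<close>

lemma DERIV_along_curve:
  assumes U: "openin (Euclidean_space n) U" and c: "smooth_curve U c"
    and D: "\<And>i x. i < n \<Longrightarrow> x \<in> U \<Longrightarrow> (\<lambda>t. g (x(i := t))) differentiable (at (x i))"
    and cont: "\<And>i. i < n \<Longrightarrow> continuous_on U (partial_deriv i g)"
  shows "((\<lambda>t. g (c t)) has_field_derivative
           (\<Sum>i<n. partial_deriv i g (c t) * deriv (\<lambda>t. c t i) t)) (at t)"
proof -
  define x where "x = c t"
  have cs: "smooth_real (\<lambda>t. c t j)" for j
    using c by (simp add: smooth_curve_def)
  have cU: "c t \<in> U" for t
    using c by (simp add: smooth_curve_def)
  have c0: "c t j = 0" if "j \<ge> n" for t j
    using openin_Euclidean_space_zero[OF U cU that] .
  obtain e where e: "e > 0" "\<forall>y. (\<forall>i\<ge>n. y i = 0) \<longrightarrow> (\<forall>i<n. \<bar>y i - x i\<bar> \<le> e) \<longrightarrow> y \<in> U"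
    unfolding x_def by (rule openin_Euclidean_space_contains_box[OF U cU])
  define P where "P = (\<lambda>\<eta>. \<forall>i<n. \<bar>c (t + \<eta>) i - x i\<bar> \<le> e)"
  have boxU: "y \<in> U" if "P \<eta>" "\<And>i. \<bar>y i - x i\<bar> \<le> \<bar>c (t + \<eta>) i - x i\<bar>" for y \<eta>
  proof -
    have "y i = 0" if "i \<ge> n" for i
      using \<open>\<And>i. \<bar>y i - x i\<bar> \<le> \<bar>c (t + \<eta>) i - x i\<bar>\<close>[of i] c0[OF that] by (simp add: x_def)
    moreover have "\<bar>y i - x i\<bar> \<le> e" if "i < n" for i
      using \<open>\<And>i. \<bar>y i - x i\<bar> \<le> \<bar>c (t + \<eta>) i - x i\<bar>\<close>[of i] \<open>P \<eta>\<close> that unfolding P_def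
      by (meson order_trans)
    ultimately show ?thesis
      using e(2) by blast
  qed
  obtain d where d: "d > 0" "d \<le> 1" "\<forall>s. \<bar>s - t\<bar> \<le> d \<longrightarrow> (\<forall>i<n. \<bar>c s i - c t i\<bar> \<le> e)"
    by (rule smooth_real_bounded_near[of "\<lambda>i t. c t i", OF cs e(1), of t n])
  have evP: "eventually P (at 0)"
    using eventually_at_in_open'[of "{-d<..<d}" 0] d(1)
    by (auto simp: P_def x_def intro!: d(3)[rule_format] elim!: eventually_mono)
  \<comment> \<open>\<open>z k\<close> takes its first \<open>k\<close> coordinates from the moved
    point and the others from \<open>x\<close>, so it leads from \<open>x\<close> to
    \<open>c (t + \<eta>)\<close>.\<close>
  define z where "z = (\<lambda>k \<eta> i. if i < k then c (t + \<eta>) i else x i)"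
  define Q where "Q = (\<lambda>k \<eta> \<xi>. \<xi> \<in> U \<and> (\<forall>i. \<bar>\<xi> i - x i\<bar> \<le> \<bar>c (t + \<eta>) i - x i\<bar>) \<and>
      g (z (Suc k) \<eta>) - g (z k \<eta>) = (c (t + \<eta>) k - x k) * partial_deriv k g \<xi>)"
  have exQ: "\<exists>\<xi>. Q k \<eta> \<xi>"
    if "P \<eta>" "k < n" for k \<eta>
  proof -
    define w where "w = z k \<eta>"
    have w: "w k = x k" "w(k := x k) = z k \<eta>" "w(k := c (t + \<eta>) k) = z (Suc k) \<eta>"
      by (auto simp: w_def z_def fun_eq_iff less_Suc_eq)
    have near: "\<bar>(w(k := s)) i - x i\<bar> \<le> \<bar>c (t + \<eta>) i - x i\<bar>"
      if "\<bar>s - x k\<bar> \<le> \<bar>c (t + \<eta>) k - x k\<bar>" for s i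
      using that by (auto simp: w_def z_def)
    have "((\<lambda>s. g (w(k := s))) has_field_derivative partial_deriv k g (w(k := s))) (at s)"
      if "\<bar>s - x k\<bar> \<le> \<bar>c (t + \<eta>) k - x k\<bar>" for s
    proof -
      have "w(k := s) \<in> U"
        using boxU[OF \<open>P \<eta>\<close> near[OF that]] .
      from D[OF \<open>k < n\<close> this] show ?thesis
        by (simp add: partial_deriv_def DERIV_deriv_iff_real_differentiable)
    qed
    from MVT_unordered[OF this] obtain s where s: "\<bar>s - x k\<bar> \<le> \<bar>c (t + \<eta>) k - x k\<bar>"
      "g (w(k := c (t + \<eta>) k)) - g (w(k := x k)) = (c (t + \<eta>) k - x k) * partial_deriv k g (w(k := s))"
      by blast
    then show ?thesis
      using boxU[OF \<open>P \<eta>\<close> near[OF s(1)]] near[OF s(1)] unfolding w Q_def by blast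
  qed
  \<comment> \<open>One mean value point is chosen for every \<open>\<eta>\<close>, giving a
    function of \<open>\<eta>\<close> whose coordinates are squeezed towards those of
    \<open>x\<close>.\<close>
  define \<xi> where "\<xi> = (\<lambda>k \<eta>. SOME \<xi>. Q k \<eta> \<xi>)"
  have "Q k \<eta> (\<xi> k \<eta>)" if "P \<eta>" "k < n" for k \<eta>
    unfolding \<xi>_def using exQ[OF that] by (rule someI_ex)
  then have \<xi>: "\<And>k \<eta>. P \<eta> \<Longrightarrow> k < n \<Longrightarrow> \<xi> k \<eta> \<in> U"
    "\<And>k \<eta> i. P \<eta> \<Longrightarrow> k < n \<Longrightarrow> \<bar>\<xi> k \<eta> i - x i\<bar> \<le> \<bar>c (t + \<eta>) i - x i\<bar>"
    "\<And>k \<eta>. P \<eta> \<Longrightarrow> k < n \<Longrightarrow>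
      g (z (Suc k) \<eta>) - g (z k \<eta>) = (c (t + \<eta>) k - x k) * partial_deriv k g (\<xi> k \<eta>)"
    unfolding Q_def by blast+
  have D1: "((\<lambda>\<eta>. (c (t + \<eta>) i - x i) / \<eta>) \<longlongrightarrow> deriv (\<lambda>t. c t i) t) (at 0)" for i
    using smooth_real_DERIV[OF cs[of i], of t] by (simp add: DERIV_def x_def)
  have lim0: "((\<lambda>\<eta>. \<bar>c (t + \<eta>) i - x i\<bar>) \<longlongrightarrow> 0) (at 0)" for i
  proof -
    have "((\<lambda>\<eta>. (c (t + \<eta>) i - x i) / \<eta> * \<eta>) \<longlongrightarrow> deriv (\<lambda>t. c t i) t * 0) (at 0)"
      by (intro tendsto_intros D1)
    moreover have "eventually (\<lambda>\<eta>. (c (t + \<eta>) i - x i) / \<eta> * \<eta> = c (t + \<eta>) i - x i) (at 0)"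
      using eventually_neq_at_within[of 0] by eventually_elim simp
    ultimately have "((\<lambda>\<eta>. c (t + \<eta>) i - x i) \<longlongrightarrow> 0) (at 0)"
      by (simp add: tendsto_cong)
    then show ?thesis
      by (rule tendsto_rabs_zero)
  qed
  have lim: "((\<lambda>\<eta>. partial_deriv k g (\<xi> k \<eta>)) \<longlongrightarrow> partial_deriv k g x) (at 0)" if k: "k < n" for k
  proof (rule continuous_on_tendsto_compose[OF cont[OF k]])
    show "(\<xi> k \<longlongrightarrow> x) (at 0)"
    proof (rule tendsto_funI)
      fix i
      have "((\<lambda>\<eta>. \<xi> k \<eta> i - x i) \<longlongrightarrow> 0) (at 0)"
      proof (rule Lim_null_comparison[OF _ lim0])
        show "eventually (\<lambda>\<eta>. norm (\<xi> k \<eta> i - x i) \<le> \<bar>c (t + \<eta>) i - x i\<bar>) (at 0)"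
          using evP by eventually_elim (simp add: \<xi>(2) k)
      qed
      then show "((\<lambda>\<eta>. \<xi> k \<eta> i) \<longlongrightarrow> x i) (at 0)"
        using LIM_zero_iff by blast
    qed
    show "x \<in> U"
      by (simp add: x_def cU)
    show "eventually (\<lambda>\<eta>. \<xi> k \<eta> \<in> U) (at 0)"
      using evP by eventually_elim (simp add: \<xi>(1) k)
  qed
  have "((\<lambda>\<eta>. \<Sum>k<n. partial_deriv k g (\<xi> k \<eta>) * ((c (t + \<eta>) k - x k) / \<eta>)) \<longlongrightarrow>
      (\<Sum>k<n. partial_deriv k g x * deriv (\<lambda>t. c t k) t)) (at 0)"
    by (intro tendsto_sum tendsto_mult lim D1) simp
  moreover have "eventually (\<lambda>\<eta>. (\<Sum>k<n. partial_deriv k g (\<xi> k \<eta>) * ((c (t + \<eta>) k - x k) / \<eta>))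
      = (g (c (t + \<eta>)) - g (c t)) / \<eta>) (at 0)"
    using evP
  proof eventually_elim
    case (elim \<eta>)
    have z: "z 0 \<eta> = c t" "z n \<eta> = c (t + \<eta>)"
      using c0 by (auto simp: z_def x_def fun_eq_iff)
    have "(\<Sum>k<n. partial_deriv k g (\<xi> k \<eta>) * ((c (t + \<eta>) k - x k) / \<eta>))
        = (\<Sum>k<n. g (z (Suc k) \<eta>) - g (z k \<eta>)) / \<eta>"
      unfolding sum_divide_distrib by (intro sum.cong) (simp_all add: \<xi>(3)[OF elim])
    then show ?case
      using sum_lessThan_telescope[of "\<lambda>k. g (z k \<eta>)" n] by (simp add: z)
  qed
  ultimately show ?thesis
    by (simp add: DERIV_def x_def tendsto_cong)
qed

lemma diffble_upto_sum:
  "(\<And>i. i \<in> I \<Longrightarrow> diffble_upto k (f i)) \<Longrightarrow> diffble_upto k (\<lambda>x. \<Sum>i\<in>I. f i x)"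
  by (induction I rule: infinite_finite_induct) (auto intro: diffble_upto_const diffble_upto_add)

text \<open>By the chain rule the derivative is a sum of products of partial derivatives along
  \<open>c\<close>, again smooth, with smooth functions; hence induction on the order over all
  \<open>g\<close>.\<close>

lemma smooth_on_imp_curve_smooth:
  assumes U: "openin (Euclidean_space n) U" and "smooth_on n U g"
  shows "curve_smooth U g"
  unfolding curve_smooth_def
proof (intro allI impI)
  fix c
  assume c: "smooth_curve U c"
  have pd: "smooth_on n U (partial_deriv i g)" if "smooth_on n U g" "i < n" for g i
  proof -
    have "Ck_on (Suc k) n U g" for k
      using that(1) by (simp only: smooth_on_def)
    then show ?thesis
      using that(2) by (simp add: smooth_on_def)
  qed
  have DERIV: "((\<lambda>t. g (c t)) has_field_derivative
      (\<Sum>i<n. partial_deriv i g (c t) * deriv (\<lambda>t. c t i) t)) (at t)" if "smooth_on n U g" for g t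
  proof -
    have "Ck_on (Suc 0) n U g"
      using that by (simp only: smooth_on_def)
    then show ?thesis
      by (intro DERIV_along_curve[OF U c, where g = g]) simp_all
  qed
  have "smooth_on n U g \<Longrightarrow> diffble_upto k (\<lambda>t. g (c t))" for k
  proof (induction k arbitrary: g)
    case (0 g)
    then show ?case
      unfolding diffble_upto_0 using DERIV real_differentiable_def by blast
  next
    case (Suc k g)
    have "diffble_upto k (\<lambda>t. \<Sum>i<n. partial_deriv i g (c t) * deriv (\<lambda>t. c t i) t)"
    proof (intro diffble_upto_sum diffble_upto_mult)
      fix i
      assume "i \<in> {..<n}"
      then show "diffble_upto k (\<lambda>t. partial_deriv i g (c t))"
        using Suc.IH pd[OF Suc.prems] by blast
      show "diffble_upto k (deriv (\<lambda>t. c t i))"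
        using c smooth_real_deriv by (simp add: smooth_curve_def smooth_real_iff_upto)
    qed
    then show ?case
      using diffble_upto_cong_deriv[OF DERIV[OF Suc.prems]] by simp
  qed
  then show "smooth_real (\<lambda>t. g (c t))"
    using assms(2) smooth_real_iff_upto by blast
qed

theorem smooth_on_iff_curve_smooth:
  "openin (Euclidean_space n) U \<Longrightarrow> smooth_on n U g \<longleftrightarrow> curve_smooth U g"
  using smooth_on_imp_curve_smooth curve_smooth_imp_smooth_on by blast

section \<open>The fine diffeology\<close>

text \<open>The weakly smooth maps, tested by all linear functionals. They turn out to be the fine
  diffeology, and their description fits the Froelicher side.\<close>

definition linear_smooth_plots :: "('a::real_vector) plots" where
  "linear_smooth_plots = {(n, U, p). openin (Euclidean_space n) U \<and> p \<in> extensional U \<and>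
     (\<forall>l::'a \<Rightarrow> real. linear l \<longrightarrow> curve_smooth U (\<lambda>x. l (p x)))}"

section \<open>Restriction, substitution and gluing for \<open>curve_smooth\<close>\<close>

lemma curve_smooth_cong:
  assumes "\<And>x. x \<in> U \<Longrightarrow> f x = g x"
  shows "curve_smooth U f \<longleftrightarrow> curve_smooth U g"
proof -
  have "(\<lambda>t. f (c t)) = (\<lambda>t. g (c t))" if "smooth_curve U c" for c
    using assms that by (auto simp: smooth_curve_def)
  then show ?thesis
    by (auto simp: curve_smooth_def)
qed

lemma curve_smooth_mono: "curve_smooth U f \<Longrightarrow> W \<subseteq> U \<Longrightarrow> curve_smooth W f"
  unfolding curve_smooth_def smooth_curve_def by blast

text \<open>The coordinates of \<open>h\<close> are smooth along curves by the chain rule, so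
  \<open>h\<close> carries smooth curves in \<open>V\<close> to smooth curves in
  \<open>U\<close>.\<close>

lemma curve_smooth_compose:
  assumes V: "openin (Euclidean_space m) V" and U: "openin (Euclidean_space n) U"
    and h: "smooth_map m V n U h" and g: "curve_smooth U g"
  shows "curve_smooth V (\<lambda>x. g (h x))"
  unfolding curve_smooth_def
proof (intro allI impI)
  fix c assume c: "smooth_curve V c"
  have hU: "h (c t) \<in> U" for t
    using h c by (auto simp: smooth_map_def smooth_curve_def)
  have "smooth_real (\<lambda>t. h (c t) j)" for j
  proof (cases "j < n")
    case True
    then have "curve_smooth V (\<lambda>x. h x j)"
      using h smooth_on_iff_curve_smooth[OF V] by (simp add: smooth_map_def)
    then show ?thesis
      using c by (simp add: curve_smooth_def)
  next
    case False
    then show ?thesis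
      using openin_Euclidean_space_zero[OF U hU] smooth_real_const by simp
  qed
  then have "smooth_curve U (\<lambda>t. h (c t))"
    using hU by (simp add: smooth_curve_def)
  then show "smooth_real (\<lambda>t. g (h (c t)))"
    using g by (simp add: curve_smooth_def)
qed

lemma curve_smooth_Union:
  assumes "\<And>W. W \<in> \<W> \<Longrightarrow> openin (Euclidean_space n) W" "\<And>W. W \<in> \<W> \<Longrightarrow> curve_smooth W g"
  shows "curve_smooth (\<Union>\<W>) g"
  unfolding curve_smooth_def
proof (intro allI impI smooth_real_locally)
  fix c t0 assume c: "smooth_curve (\<Union>\<W>) c"
  then obtain W where W: "W \<in> \<W>" "c t0 \<in> W"
    by (auto simp: smooth_curve_def)
  have "c t i = 0" if "i \<ge> n" for t i
  proof -
    obtain W' where "W' \<in> \<W>" "c t \<in> W'"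
      using c by (auto simp: smooth_curve_def)
    then show ?thesis
      using assms(1) openin_Euclidean_space_zero[OF _ _ that] by blast
  qed
  moreover have "smooth_real (\<lambda>t. c t i)" for i
    using c by (simp add: smooth_curve_def)
  ultimately obtain d where d: "d > 0" "smooth_curve W (\<lambda>t. c (t0 + cutoff d (t - t0)))"
    using localize_curve[OF assms(1)[OF W(1)], of c t0] W(2) by metis
  then have "smooth_real (\<lambda>t. g (c (t0 + cutoff d (t - t0))))"
    using assms(2)[OF W(1)] by (simp add: curve_smooth_def)
  moreover have "eventually (\<lambda>t. g (c t) = g (c (t0 + cutoff d (t - t0)))) (nhds t0)"
    using eventually_cutoff[OF d(1)] by eventually_elim simp
  ultimately show "\<exists>f. smooth_real f \<and> eventually (\<lambda>t. g (c t) = f t) (nhds t0)"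
    by (intro exI[of _ "\<lambda>t. g (c (t0 + cutoff d (t - t0)))"]) simp
qed

section \<open>Weakly smooth maps form a vector space diffeology\<close>

lemma diffeology_linear_smooth_plots: "diffeology (linear_smooth_plots :: ('a::real_vector) plots)"
  unfolding diffeology_def
proof (intro conjI allI impI)
  show "\<forall>(n, U, p)\<in>linear_smooth_plots. openin (Euclidean_space n) U \<and> (p :: _ \<Rightarrow> 'a) \<in> extensional U"
    by (auto simp: linear_smooth_plots_def)
next
  fix n U and c :: 'a
  assume U: "openin (Euclidean_space n) U"
  have "curve_smooth U (\<lambda>x. l ((\<lambda>x\<in>U. c) x))" for l :: "'a \<Rightarrow> real"
    by (subst curve_smooth_cong[of _ _ "\<lambda>_. l c"]) (auto simp: curve_smooth_def smooth_real_const)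
  then show "(n, U, \<lambda>x\<in>U. c) \<in> linear_smooth_plots"
    using U by (simp add: linear_smooth_plots_def)
next
  fix n U m V h and p :: "_ \<Rightarrow> 'a"
  assume a: "(n, U, p) \<in> linear_smooth_plots \<and> openin (Euclidean_space m) V \<and> smooth_map m V n U h"
  have "curve_smooth V (\<lambda>x. l (compose V p h x))" if "linear l" for l :: "'a \<Rightarrow> real"
    using curve_smooth_compose[of m V n U h "\<lambda>x. l (p x)"] a that
    by (subst curve_smooth_cong[of _ _ "\<lambda>x. l (p (h x))"])
      (auto simp: linear_smooth_plots_def compose_def)
  then show "(m, V, compose V p h) \<in> linear_smooth_plots"
    using a by (simp add: linear_smooth_plots_def)
next
  fix n U \<W> and p :: "_ \<Rightarrow> 'a"
  assume a: "p \<in> extensional U \<and> U = \<Union>\<W> \<and>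
    (\<forall>W\<in>\<W>. openin (Euclidean_space n) W \<and> (n, W, restrict p W) \<in> linear_smooth_plots)"
  have "curve_smooth U (\<lambda>x. l (p x))" if l: "linear l" for l :: "'a \<Rightarrow> real"
  proof -
    have "curve_smooth W (\<lambda>x. l (p x))" if "W \<in> \<W>" for W
      using a that l curve_smooth_cong[of W "\<lambda>x. l (restrict p W x)" "\<lambda>x. l (p x)"]
      by (simp add: linear_smooth_plots_def)
    then show ?thesis
      using a curve_smooth_Union[of \<W> n "\<lambda>x. l (p x)"] by simp
  qed
  moreover have "openin (Euclidean_space n) U"
    using a by (auto intro: openin_Union)
  ultimately show "(n, U, p) \<in> linear_smooth_plots"
    using conjunct1[OF a] by (simp add: linear_smooth_plots_def)
qed

lemma diffeological_vector_space_linear_smooth_plots: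
  "diffeological_vector_space (linear_smooth_plots :: ('a::real_vector) plots)"
  unfolding diffeological_vector_space_def
proof (intro conjI diffeology_linear_smooth_plots)
  show "diff_smooth (prod_diffeology linear_smooth_plots linear_smooth_plots)
      (linear_smooth_plots :: 'a plots) (\<lambda>(x, y). x + y)"
    unfolding diff_smooth_def
  proof (clarify)
    fix n U and p :: "_ \<Rightarrow> 'a \<times> 'a"
    assume "(n, U, p) \<in> prod_diffeology linear_smooth_plots linear_smooth_plots"
    then have U: "openin (Euclidean_space n) U" and
      c: "\<And>l::'a \<Rightarrow> real. linear l \<Longrightarrow> curve_smooth U (\<lambda>x. l (compose U fst p x))"
        "\<And>l::'a \<Rightarrow> real. linear l \<Longrightarrow> curve_smooth U (\<lambda>x. l (compose U snd p x))"
      by (auto simp: prod_diffeology_def linear_smooth_plots_def)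
    have "curve_smooth U (\<lambda>x. l (compose U (\<lambda>(x, y). x + y) p x))" if l: "linear l" for l :: "'a \<Rightarrow> real"
    proof -
      have "curve_smooth U (\<lambda>x. l (compose U fst p x) + l (compose U snd p x))"
        using c[OF l] by (simp add: curve_smooth_def smooth_real_add)
      then show ?thesis
        by (subst curve_smooth_cong[of _ _ "\<lambda>x. l (compose U fst p x) + l (compose U snd p x)"])
          (auto simp: compose_def split_beta linear_add[OF l])
    qed
    then show "(n, U, compose U (\<lambda>(x, y). x + y) p) \<in> (linear_smooth_plots :: 'a plots)"
      using U by (simp add: linear_smooth_plots_def)
  qed
  show "diff_smooth (prod_diffeology real_diffeology linear_smooth_plots)
      (linear_smooth_plots :: 'a plots) (\<lambda>(r, x). r *\<^sub>R x)"
    unfolding diff_smooth_def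
  proof (clarify)
    fix n U and p :: "_ \<Rightarrow> real \<times> 'a"
    assume a: "(n, U, p) \<in> prod_diffeology real_diffeology linear_smooth_plots"
    then have U: "openin (Euclidean_space n) U" and
      c: "\<And>l::'a \<Rightarrow> real. linear l \<Longrightarrow> curve_smooth U (\<lambda>x. l (compose U snd p x))"
      by (auto simp: prod_diffeology_def linear_smooth_plots_def)
    have r: "curve_smooth U (compose U fst p)"
      using a smooth_on_iff_curve_smooth[OF U] by (simp add: prod_diffeology_def real_diffeology_def)
    have "curve_smooth U (\<lambda>x. l (compose U (\<lambda>(r, x). r *\<^sub>R x) p x))" if l: "linear l" for l :: "'a \<Rightarrow> real"
    proof -
      have "curve_smooth U (\<lambda>x. compose U fst p x * l (compose U snd p x))"
        using c[OF l] r by (simp add: curve_smooth_def smooth_real_mult)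
      then show ?thesis
        by (subst curve_smooth_cong[of _ _ "\<lambda>x. compose U fst p x * l (compose U snd p x)"])
          (auto simp: compose_def split_beta linear_scale[OF l])
    qed
    then show "(n, U, compose U (\<lambda>(r, x). r *\<^sub>R x) p) \<in> (linear_smooth_plots :: 'a plots)"
      using U by (simp add: linear_smooth_plots_def)
  qed
qed

section \<open>Local finite-dimensionality of weakly smooth maps\<close>

lemma ex_linear_unbounded_on_sequence:
  fixes v :: "nat \<Rightarrow> 'a::real_vector"
  assumes v: "\<And>m. v m \<notin> span (v ` {..<m})"
  shows "\<exists>l::'a \<Rightarrow> real. linear l \<and> (\<forall>m. l (v m) = real m)"
proof -
  have ind: "independent (v ` {..<m})" for m
  proof (induction m)
    case (Suc m)
    then show ?case
      using v[of m] by (simp add: lessThan_Suc independent_insertI)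
  qed (simp add: independent_empty)
  have "v i \<noteq> v j" if "i < j" for i j
    using v[of j] that span_base[of "v i" "v ` {..<j}"] by (metis imageI lessThan_iff)
  then have inj: "inj v"
    by (metis injI linorder_neqE_nat)
  \<comment> \<open>Finite initial parts are independent and form a chain, so the whole sequence is
    independent and a linear functional can be prescribed freely on it.\<close>
  have "independent (\<Union>m. v ` {..<m})"
  proof (rule independent_Union_directed)
    fix c d
    assume "c \<in> range (\<lambda>m. v ` {..<m})" "d \<in> range (\<lambda>m. v ` {..<m})"
    then obtain i j where "c = v ` {..<i}" "d = v ` {..<j}"
      by blast
    then show "c \<subseteq> d \<or> d \<subseteq> c"
      by (metis image_mono lessThan_subset_iff nat_le_linear)
  qed (use ind in auto)
  moreover have "(\<Union>m. v ` {..<m}) = range v"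
    by auto
  ultimately have "independent (range v)"
    by simp
  from linear_independent_extend[OF this, of "\<lambda>x. real (inv v x)"]
  obtain l :: "'a \<Rightarrow> real" where "linear l" "\<forall>x\<in>range v. l x = real (inv v x)"
    by blast
  then show ?thesis
    using inv_f_f[OF inj] by auto
qed

text \<open>If the values of \<open>p\<close> near \<open>x\<close> spanned an infinite-dimensional space, there would be
  \<open>y m\<close> tending to \<open>x\<close> with all \<open>p (y m)\<close> linearly independent, and a linear \<open>l\<close> with
  \<open>l (p (y m)) = m\<close>, although \<open>l \<circ> p\<close> is continuous at \<open>x\<close>.\<close>

lemma locally_finite_dimensional:
  fixes p :: "(nat \<Rightarrow> real) \<Rightarrow> 'a::real_vector"
  assumes U: "openin (Euclidean_space n) U" and x: "x \<in> U"
    and p: "\<And>l::'a \<Rightarrow> real. linear l \<Longrightarrow> continuous_on U (\<lambda>x. l (p x))"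
  shows "\<exists>e>0. \<exists>B. finite B \<and> p ` (U \<inter> {y. \<forall>i<n. \<bar>y i - x i\<bar> < e}) \<subseteq> span B"
proof (rule ccontr)
  assume no: "\<not> ?thesis"
  define N where "N = (\<lambda>m::nat. U \<inter> {y. \<forall>i<n. \<bar>y i - x i\<bar> < inverse (real (Suc m))})"
  define P where "P = (\<lambda>y m r. r \<in> N m \<and> p r \<notin> span ((\<lambda>i. p (y i)) ` {..<m}))"
  have "\<exists>y. \<forall>m. P y m (y m)"
  proof (rule dependent_wellorder_choice)
    fix r and y y' :: "nat \<Rightarrow> nat \<Rightarrow> real" and m :: nat
    assume "\<And>i. i < m \<Longrightarrow> y i = y' i"
    then have "(\<lambda>i. p (y i)) ` {..<m} = (\<lambda>i. p (y' i)) ` {..<m}"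
      by (intro image_cong) auto
    then show "P y m r = P y' m r"
      by (simp add: P_def)
  next
    fix m :: nat and y :: "nat \<Rightarrow> nat \<Rightarrow> real"
    have "inverse (real (Suc m)) > 0"
      by simp
    moreover have "finite ((\<lambda>i. p (y i)) ` {..<m})"
      by simp
    \<comment> \<open>The negated claim is applied to the finite set of values chosen so far, which
      yields a new value outside their span.\<close>
    ultimately have "\<not> p ` N m \<subseteq> span ((\<lambda>i. p (y i)) ` {..<m})"
      using no unfolding N_def by meson
    then show "\<exists>r. P y m r"
      unfolding P_def by blast
  qed
  then obtain y where "\<forall>m. P y m (y m)"
    by (rule exE)
  then have y: "\<And>m. y m \<in> N m" "\<And>m. p (y m) \<notin> span ((\<lambda>i. p (y i)) ` {..<m})"
    unfolding P_def by simp_all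
  obtain l :: "'a \<Rightarrow> real" where l: "linear l" "\<And>m. l (p (y m)) = real m"
    using ex_linear_unbounded_on_sequence[OF y(2)] by blast
  have yU: "y m \<in> U" for m
    using y(1)[of m] by (simp add: N_def)
  have "y \<longlonglongrightarrow> x"
  proof (rule tendsto_funI)
    fix i
    show "(\<lambda>m. y m i) \<longlonglongrightarrow> x i"
    proof (cases "i < n")
      case True
      have "\<bar>y m i - x i\<bar> \<le> inverse (real (Suc m))" for m
        using y(1)[of m] True unfolding N_def by (auto intro: less_imp_le)
      then have "(\<lambda>m. y m i - x i) \<longlonglongrightarrow> 0"
        by (intro Lim_null_comparison[OF _ LIMSEQ_inverse_real_of_nat]) (simp del: of_nat_Suc)
      then show ?thesis
        using LIM_zero_iff by blast
    next
      case False
      then show ?thesis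
        using openin_Euclidean_space_zero[OF U yU] openin_Euclidean_space_zero[OF U x] by simp
    qed
  qed
  from continuous_on_tendsto_compose[OF p[OF l(1)] this x] have "(\<lambda>m. real m) \<longlonglongrightarrow> l (p x)"
    using yU l(2) by simp
  then show False
    using not_tendsto_and_filterlim_at_infinity[of sequentially real]
      filterlim_at_top_imp_at_infinity[OF filterlim_real_sequentially] by simp
qed

section \<open>Weakly smooth maps are plots of every vector space diffeology\<close>

lemma diffeological_vector_space_constant:
  assumes "diffeological_vector_space D" "openin (Euclidean_space n) U"
  shows "(n, U, \<lambda>x\<in>U. c) \<in> D"
proof -
  have "\<forall>n U c. openin (Euclidean_space n) U \<longrightarrow> (n, U, \<lambda>x\<in>U. c) \<in> D"
    using assms(1) unfolding diffeological_vector_space_def diffeology_def by (elim conjE)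
  then show ?thesis
    using assms(2) by simp
qed

lemma diffeological_vector_space_local:
  assumes "diffeological_vector_space D" "p \<in> extensional U" "U = \<Union>\<W>"
    "\<forall>W\<in>\<W>. openin (Euclidean_space n) W \<and> (n, W, restrict p W) \<in> D"
  shows "(n, U, p) \<in> D"
proof -
  have "\<forall>n U p \<W>. p \<in> extensional U \<and> U = \<Union>\<W> \<and>
      (\<forall>W\<in>\<W>. openin (Euclidean_space n) W \<and> (n, W, restrict p W) \<in> D) \<longrightarrow> (n, U, p) \<in> D"
    using assms(1) unfolding diffeological_vector_space_def diffeology_def by (elim conjE)
  from this[rule_format, of p U \<W> n] show ?thesis
    using assms(2-4) by simp
qed

lemma diffeological_vector_space_add:
  assumes D: "diffeological_vector_space D"
    and u: "(n, U, \<lambda>x\<in>U. u x) \<in> D" and v: "(n, U, \<lambda>x\<in>U. v x) \<in> D"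
  shows "(n, U, \<lambda>x\<in>U. u x + v x) \<in> D"
proof -
  have "(n, U, \<lambda>x\<in>U. (u x, v x)) \<in> prod_diffeology D D"
    using u v by (simp add: prod_diffeology_def compose_def cong: restrict_cong)
  then have "(n, U, compose U (\<lambda>(x, y). x + y) (\<lambda>x\<in>U. (u x, v x))) \<in> D"
    using D unfolding diffeological_vector_space_def diff_smooth_def by blast
  then show ?thesis
    by (simp add: compose_def cong: restrict_cong)
qed

lemma diffeological_vector_space_scaleR:
  assumes D: "diffeological_vector_space D" and U: "openin (Euclidean_space n) U"
    and u: "curve_smooth U u"
  shows "(n, U, \<lambda>x\<in>U. u x *\<^sub>R b) \<in> D"
proof -
  have "smooth_on n U (\<lambda>x\<in>U. u x)"
    using u curve_smooth_cong[of U "\<lambda>x\<in>U. u x" u] smooth_on_iff_curve_smooth[OF U] by simp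
  then have "(n, U, \<lambda>x\<in>U. (u x, b)) \<in> prod_diffeology real_diffeology D"
    using U diffeological_vector_space_constant[OF D U, of b]
    by (simp add: prod_diffeology_def real_diffeology_def compose_def cong: restrict_cong)
  then have "(n, U, compose U (\<lambda>(r, x). r *\<^sub>R x) (\<lambda>x\<in>U. (u x, b))) \<in> D"
    using D unfolding diffeological_vector_space_def diff_smooth_def by blast
  then show ?thesis
    by (simp add: compose_def cong: restrict_cong)
qed

lemma diffeological_vector_space_sum:
  assumes D: "diffeological_vector_space D" and U: "openin (Euclidean_space n) U"
    and "finite B" "\<And>b. b \<in> B \<Longrightarrow> curve_smooth U (u b)"
  shows "(n, U, \<lambda>x\<in>U. \<Sum>b\<in>B. u b x *\<^sub>R b) \<in> D"
  using assms(3,4)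
proof (induction B)
  case empty
  then show ?case
    using diffeological_vector_space_constant[OF D U, of 0] by (simp add: restrict_def)
next
  case (insert b B)
  have "(n, U, \<lambda>x\<in>U. u b x *\<^sub>R b + (\<Sum>b\<in>B. u b x *\<^sub>R b)) \<in> D"
    by (intro diffeological_vector_space_add[OF D] diffeological_vector_space_scaleR[OF D U] insert)
      simp_all
  then show ?case
    using insert.hyps by (simp add: restrict_def)
qed

text \<open>Basis coordinates of the span extend to linear functionals on the whole space, so
  \<open>p\<close> is a finite sum of smooth scalar functions times constant vectors.\<close>

lemma diffeological_vector_space_finite_dimensional:
  fixes p :: "(nat \<Rightarrow> real) \<Rightarrow> 'a::real_vector"
  assumes D: "diffeological_vector_space D" and U: "openin (Euclidean_space n) U"
    and B: "finite B" "p ` U \<subseteq> span B"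
    and p: "\<And>l::'a \<Rightarrow> real. linear l \<Longrightarrow> curve_smooth U (\<lambda>x. l (p x))"
  shows "(n, U, restrict p U) \<in> D"
proof -
  obtain B' where B': "B' \<subseteq> B" "independent B'" "B \<subseteq> span B'"
    using maximal_independent_subset by blast
  have fin: "finite B'"
    using B' B(1) finite_subset by blast
  have "\<exists>l::'a \<Rightarrow> real. linear l \<and> (\<forall>x\<in>B'. l x = (if x = b then 1 else 0))" for b
    using linear_independent_extend[OF B'(2), of "\<lambda>x. if x = b then 1 else (0::real)"] by blast
  then obtain l where l: "\<And>b. linear (l b :: 'a \<Rightarrow> real)"
    "\<And>b x. x \<in> B' \<Longrightarrow> l b x = (if x = b then 1 else 0)"
    by metis
  \<comment> \<open>A linear projection onto \<open>span B'\<close>: it fixes the basis, hence every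
    value of \<open>p\<close>.\<close>
  define T where "T = (\<lambda>v. \<Sum>b\<in>B'. l b v *\<^sub>R b)"
  have "linear T"
    unfolding T_def
    by (intro linearI)
      (simp_all add: linear_add[OF l(1)] linear_scale[OF l(1)] scaleR_left_distrib sum.distrib
        scaleR_sum_right)
  moreover have "T b = b" if "b \<in> B'" for b
  proof -
    have "T b = (\<Sum>b'\<in>B'. if b = b' then b' else 0)"
      unfolding T_def by (intro sum.cong) (simp_all add: l(2)[OF that])
    also have "\<dots> = b"
      using fin that by simp
    finally show ?thesis .
  qed
  ultimately have T: "T v = v" if "v \<in> span B'" for v
    using linear_eq_on_span[of T "\<lambda>v. v" B' v] that by (simp add: linear_id[unfolded id_def])
  have "span B \<subseteq> span B'"
    using B'(3) span_mono[of B "span B'"] by (simp add: span_span)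
  then have "restrict p U = (\<lambda>x\<in>U. \<Sum>b\<in>B'. l b (p x) *\<^sub>R b)"
    using T B(2) by (intro restrict_ext) (auto simp: T_def subset_iff image_subset_iff)
  then show ?thesis
    using diffeological_vector_space_sum[OF D U fin, of "\<lambda>b x. l b (p x)"] p l(1) by simp
qed

text \<open>Around every point \<open>p\<close> takes values in a finite-dimensional subspace on
  some box, where it is a plot; the sheaf axiom glues the boxes.\<close>

lemma linear_smooth_plots_subset:
  assumes D: "diffeological_vector_space D"
  shows "linear_smooth_plots \<subseteq> D"
proof clarify
  fix n U and p :: "(nat \<Rightarrow> real) \<Rightarrow> 'a"
  assume "(n, U, p) \<in> linear_smooth_plots"
  then have U: "openin (Euclidean_space n) U" and ext: "p \<in> extensional U"
    and p: "\<And>l::'a \<Rightarrow> real. linear l \<Longrightarrow> curve_smooth U (\<lambda>x. l (p x))"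
    by (auto simp: linear_smooth_plots_def)
  define \<W> where "\<W> = {W. W \<subseteq> U \<and> openin (Euclidean_space n) W \<and> (n, W, restrict p W) \<in> D}"
  have "U \<subseteq> \<Union>\<W>"
  proof
    fix x assume x: "x \<in> U"
    obtain e B where e: "e > 0" "finite B"
      "p ` (U \<inter> {y. \<forall>i<n. \<bar>y i - x i\<bar> < e}) \<subseteq> span B"
      using locally_finite_dimensional[of n U x p] U x curve_smooth_continuous_on[OF U p] by blast
    let ?W = "U \<inter> {y. \<forall>i<n. \<bar>y i - x i\<bar> < e}"
    have W: "openin (Euclidean_space n) ?W"
      by (rule openin_Euclidean_space_Int_box[OF U])
    have "(n, ?W, restrict p ?W) \<in> D"
      using diffeological_vector_space_finite_dimensional[OF D W e(2,3)] curve_smooth_mono[OF p]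
      by blast
    then have "?W \<in> \<W>"
      using W by (simp add: \<W>_def)
    moreover have "x \<in> ?W"
      using x e(1) by simp
    ultimately show "x \<in> \<Union>\<W>"
      by blast
  qed
  then have "U = \<Union>\<W>"
    unfolding \<W>_def by blast
  moreover have "\<forall>W\<in>\<W>. openin (Euclidean_space n) W \<and> (n, W, restrict p W) \<in> D"
    by (simp add: \<W>_def)
  ultimately show "(n, U, p) \<in> D"
    by (rule diffeological_vector_space_local[OF D ext])
qed

section \<open>Identification of the fine diffeology and its Froelicher structure\<close>

lemma fine_eq_linear_smooth_plots:
  "fine_diffeological_vector_space D \<Longrightarrow> D = linear_smooth_plots"
  using linear_smooth_plots_subset diffeological_vector_space_linear_smooth_plots
  unfolding fine_diffeological_vector_space_def by blast

theorem proposition5p7: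
  fixes D :: "('a::real_vector) plots"
  assumes "fine_diffeological_vector_space D"
  shows "is_froelicher D"
proof -
  \<comment> \<open>The curves are the weakly smooth ones and \<open>F\<close> is determined by
    them. Since \<open>F\<close> contains all linear functionals, it determines \<open>C\<close> in
    turn.\<close>
  define C where "C = {c :: real \<Rightarrow> 'a. \<forall>l::'a \<Rightarrow> real. linear l \<longrightarrow> smooth_real (l \<circ> c)}"
  define F where "F = {f :: 'a \<Rightarrow> real. \<forall>c\<in>C. smooth_real (f \<circ> c)}"
  have lin: "l \<in> F" if "linear l" for l
    using that by (simp add: F_def C_def)
  have "C = {c. \<forall>f\<in>F. smooth_real (f \<circ> c)}"
    using lin unfolding F_def by (auto simp: C_def)
  then have "froelicher_space C F"
    by (simp add: froelicher_space_def F_def)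
  moreover have "linear_smooth_plots = froelicher_diffeology F"
  proof (intro equalityI subsetI; clarify)
    fix n U and p :: "_ \<Rightarrow> 'a"
    assume "(n, U, p) \<in> linear_smooth_plots"
    then have U: "openin (Euclidean_space n) U" and ext: "p \<in> extensional U"
      and p: "\<And>l::'a \<Rightarrow> real. linear l \<Longrightarrow> curve_smooth U (\<lambda>x. l (p x))"
      by (auto simp: linear_smooth_plots_def)
    have "curve_smooth U (f \<circ> p)" if "f \<in> F" for f
      unfolding curve_smooth_def
    proof (intro allI impI)
      fix c assume "smooth_curve U c"
      \<comment> \<open>A weakly smooth map carries smooth curves into \<open>C\<close>, so
        \<open>f \<circ> p\<close> is smooth along curves; Boman's theorem then makes it
        smooth.\<close>
      then have "(\<lambda>t. p (c t)) \<in> C"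
        using p by (simp add: C_def curve_smooth_def o_def)
      then show "smooth_real (\<lambda>t. (f \<circ> p) (c t))"
        using \<open>f \<in> F\<close> by (simp add: F_def o_def)
    qed
    then show "(n, U, p) \<in> froelicher_diffeology F"
      using U ext smooth_on_iff_curve_smooth[OF U] by (simp add: froelicher_diffeology_def)
  next
    fix n U and p :: "_ \<Rightarrow> 'a"
    assume a: "(n, U, p) \<in> froelicher_diffeology F"
    then have U: "openin (Euclidean_space n) U"
      by (simp add: froelicher_diffeology_def)
    then show "(n, U, p) \<in> linear_smooth_plots"
      using a lin smooth_on_iff_curve_smooth[OF U]
      by (simp add: froelicher_diffeology_def linear_smooth_plots_def o_def)
  qed
  ultimately show ?thesis
    using fine_eq_linear_smooth_plots[OF assms] unfolding is_froelicher_def by blast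
qed

end
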